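(* Let $n,r$ be integers with $0\le r\le \lfloor n/2\rfloor-1$, let $k$ be a field, and let $I=I(G_{n,r})\subseteq R=k[x_1,\ldots,x_n]$ be the edge ideal of the graph $G_{n,r}$. Then the resurgence of $I$ is $$\rho(I)=\frac{2(n-(r+1))}{n}.$$
   Context: For integers $n,r$ with $0\le r\le \lfloor n/2\rfloor-1$, $G_{n,r}$ is the finite simple graph with vertex set $\{x_1,\ldots,x_n\}$ (in cyclic order, indices read modulo $n$) in which each $x_i$ is adjacent to every vertex other than $x_i$ itself and the vertices of $A_i=\{x_{i-r},\ldots,x_{i-1},x_{i+1},\ldots,x_{i+r}\}$. Equivalently, for $i<j$, $x_ix_j$ is an edge iff $r+1\le j-i\le n-(r+1)$. The edge ideal of a graph $G$ on $\{x_1,\ldots,x_n\}$ is the ideal $I(G)\subseteq R$ generated by all $x_ix_j$ with $x_ix_j$ an edge of $G$. The $s$-th symbolic power is $I^{(s)}=\bigcap_{p\in\operatorname{Ass} I}(I^sR_p\cap R)$. The resurgence is $\rho(I)=\sup\{\frac{s}{t}\mid s,t\ge 1 \text{ integers},\ I^{(s)}\nsubseteq I^t\}$. *)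

theory Defs
  imports
    "HOL-Algebra.QuotRing"
    "HOL-Algebra.Ideal_Product"
    "HOL-Computational_Algebra.Fraction_Field"
    "HOL-Library.Poly_Mapping"
    "HOL-Library.Extended_Real"
    "HOL-Number_Theory.Cong"
    "Graph_Theory.Pair_Digraph"
begin

section \<open>Polynomial rings\<close>

definition ring_on :: "'b::comm_ring_1 set \<Rightarrow> 'b ring" where
  "ring_on A = \<lparr>carrier = A, monoid.mult = (*), one = 1, zero = 0, add = (+)\<rparr>"

text \<open>A monomial is a finitely supported exponent function, a polynomial is a finitely
  supported map from monomials to coefficients.  The ring \<open>k[x\<^sub>i : i \<in> V]\<close> consists of the
  polynomials all of whose monomials involve only variables with index in \<open>V\<close>.\<close>

type_synonym 'k mpoly = "(nat \<Rightarrow>\<^sub>0 nat) \<Rightarrow>\<^sub>0 'k"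

definition mpoly_ring :: "nat set \<Rightarrow> 'k::field mpoly ring" where
  "mpoly_ring V = ring_on {f. \<forall>m \<in> Poly_Mapping.keys f. Poly_Mapping.keys m \<subseteq> V}"

definition Var :: "nat \<Rightarrow> 'k::field mpoly" where
  "Var i = Poly_Mapping.single (Poly_Mapping.single i 1) 1"

section \<open>Symbolic powers and resurgence\<close>

abbreviation ideal_power :: "'b ring \<Rightarrow> 'b set \<Rightarrow> nat \<Rightarrow> 'b set" where
  "ideal_power R I s \<equiv> I [^]\<^bsub>ideals_set R\<^esub> s"

text \<open>The associated primes of \<open>I\<close> are those of the module \<open>R/I\<close>: the prime ideals of \<open>R\<close>
  that are the annihilator of an element of \<open>R/I\<close>.\<close>

definition Ass :: "'b ring \<Rightarrow> 'b set \<Rightarrow> 'b set set" where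
  "Ass R I = {p. primeideal p R \<and>
     (\<exists>x \<in> carrier (R Quot I).
        p = {g \<in> carrier R. (I +>\<^bsub>R\<^esub> g) \<otimes>\<^bsub>R Quot I\<^esub> x = \<zero>\<^bsub>R Quot I\<^esub>})}"

text \<open>From here on, \<open>R\<close> is meant to be of the form \<^term>\<open>ring_on A\<close>, a subring of the ambient
  integral domain.  Its localization at a prime \<open>p\<close> is then a subring of the field of fractions
  of that domain, and \<open>R\<close> embeds in it by \<open>f \<mapsto> f/1\<close>.\<close>

definition localization :: "'b::idom ring \<Rightarrow> 'b set \<Rightarrow> 'b fract ring" where
  "localization R p = ring_on {Fraction_Field.Fract a u |a u. a \<in> carrier R \<and> u \<in> carrier R - p}"

definition extension :: "'b::idom ring \<Rightarrow> 'b set \<Rightarrow> 'b set \<Rightarrow> 'b fract set" where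
  "extension R p J = Idl\<^bsub>localization R p\<^esub> ((\<lambda>f. Fraction_Field.Fract f 1) ` J)"

definition contraction :: "'b::idom ring \<Rightarrow> 'b fract set \<Rightarrow> 'b set" where
  "contraction R J = {f \<in> carrier R. Fraction_Field.Fract f 1 \<in> J}"

definition symbolic_power :: "'b::idom ring \<Rightarrow> 'b set \<Rightarrow> nat \<Rightarrow> 'b set" where
  "symbolic_power R I s =
     carrier R \<inter> (\<Inter>p \<in> Ass R I. contraction R (extension R p (ideal_power R I s)))"

text \<open>The supremum is taken in the extended reals, so that it is meaningful for unbounded sets.\<close>

definition resurgence :: "'b::idom ring \<Rightarrow> 'b set \<Rightarrow> ereal" where
  "resurgence R I = Sup {ereal (real s / real t) |s t.
     1 \<le> s \<and> 1 \<le> t \<and> \<not> symbolic_power R I s \<subseteq> ideal_power R I t}"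

section \<open>The graphs and their edge ideals\<close>

text \<open>A finite simple graph is represented by a symmetric loop-free set of arcs
  (locale \<^locale>\<open>pair_graph\<close>), an edge being a pair of opposite arcs.  The vertex \<open>x\<^sub>i\<close> is
  represented by its index.\<close>

definition edge_ideal :: "nat pair_pre_digraph \<Rightarrow> 'k::field mpoly set" where
  "edge_ideal G = Idl\<^bsub>mpoly_ring (pverts G)\<^esub> {Var i * Var j |i j. (i, j) \<in> parcs G}"

definition cyc_nbhd :: "nat \<Rightarrow> nat \<Rightarrow> nat \<Rightarrow> nat set" where
  "cyc_nbhd n r i = {j \<in> {1..n}. \<exists>d \<in> {1..r}.
     [int j = int i - int d] (mod int n) \<or> [int j = int i + int d] (mod int n)}"

definition G_graph :: "nat \<Rightarrow> nat \<Rightarrow> nat pair_pre_digraph" where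
  "G_graph n r = \<lparr>pverts = {1..n},
     parcs = {(i, j). i \<in> {1..n} \<and> j \<in> {1..n} \<and> j \<noteq> i \<and> j \<notin> cyc_nbhd n r i}\<rparr>"

section \<open>Well-definedness\<close>

lemma ring_on_simps [simp]:
  "carrier (ring_on A) = A" "monoid.mult (ring_on A) = (*)" "one (ring_on A) = 1"
  "zero (ring_on A) = 0" "add (ring_on A) = (+)"
  by (simp_all add: ring_on_def)

lemma cring_ring_on:
  assumes "1 \<in> A" "\<And>a b. a \<in> A \<Longrightarrow> b \<in> A \<Longrightarrow> a + b \<in> A"
    "\<And>a b. a \<in> A \<Longrightarrow> b \<in> A \<Longrightarrow> a * b \<in> A" "\<And>a. a \<in> A \<Longrightarrow> - a \<in> A"
  shows "cring (ring_on A)"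
proof (rule cringI)
  have z: "0 \<in> A" using assms(2)[OF assms(1) assms(4)[OF assms(1)]] by simp
  show "abelian_group (ring_on A)"
    by (rule abelian_groupI)
       (use assms z in \<open>auto simp: algebra_simps intro: bexI[where x = "- x" for x]\<close>)
  show "comm_monoid (ring_on A)"
    by (rule comm_monoidI) (use assms in \<open>auto simp: algebra_simps\<close>)
qed (auto simp: algebra_simps)

lemma cring_mpoly_ring: "cring (mpoly_ring V :: 'k::field mpoly ring)"
  unfolding mpoly_ring_def
proof (rule cring_ring_on)
  fix a b :: "'k mpoly"
  assume a: "a \<in> {f. \<forall>m \<in> Poly_Mapping.keys f. Poly_Mapping.keys m \<subseteq> V}"
    and b: "b \<in> {f. \<forall>m \<in> Poly_Mapping.keys f. Poly_Mapping.keys m \<subseteq> V}"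
  show "a + b \<in> {f. \<forall>m \<in> Poly_Mapping.keys f. Poly_Mapping.keys m \<subseteq> V}"
    using a b Poly_Mapping.keys_add[of a b] by blast
  show "a * b \<in> {f. \<forall>m \<in> Poly_Mapping.keys f. Poly_Mapping.keys m \<subseteq> V}"
  proof (intro CollectI ballI)
    fix m assume "m \<in> Poly_Mapping.keys (a * b)"
    then obtain u v where "m = u + v" "u \<in> Poly_Mapping.keys a" "v \<in> Poly_Mapping.keys b"
      using Poly_Mapping.keys_mult[of a b] by blast
    then show "Poly_Mapping.keys m \<subseteq> V"
      using a b Poly_Mapping.keys_add[of u v] by blast
  qed
qed auto

lemma cring_localization:
  assumes "R = ring_on A" and p: "primeideal p R"
  shows "cring (localization R p)"
  unfolding localization_def
proof (rule cring_ring_on)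
  interpret primeideal p R by (rule p)
  have nz: "u \<noteq> 0" if "u \<in> carrier R - p" for u
    using that additive_subgroup.zero_closed[OF is_additive_subgroup] assms(1) by auto
  have mp: "u * v \<in> carrier R - p" if "u \<in> carrier R - p" "v \<in> carrier R - p" for u v
    using that I_prime[of u v] m_closed[of u v] assms(1) by auto
  have one: "1 \<in> carrier R - p"
    using one_imp_carrier I_notcarr one_closed assms(1) by auto
  have mc: "u * v \<in> carrier R" if "u \<in> carrier R" "v \<in> carrier R" for u v
    using that m_closed[of u v] assms(1) by auto
  have ac: "u + v \<in> carrier R" if "u \<in> carrier R" "v \<in> carrier R" for u v
    using that a_closed[of u v] assms(1) by auto
  have uc: "- u \<in> carrier R" if u: "u \<in> carrier R" for u
  proof -
    obtain v where "v \<in> carrier R" "v + u = 0"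
      using add.l_inv_ex[OF u] assms(1) by auto
    moreover from this have "v = - u" by (simp only: eq_neg_iff_add_eq_0)
    ultimately show ?thesis by simp
  qed
  let ?S = "{Fraction_Field.Fract a u |a u. a \<in> carrier R \<and> u \<in> carrier R - p}"
  show "1 \<in> ?S" using one by (auto simp: One_fract_def)
  fix x assume "x \<in> ?S"
  then obtain a u where x: "x = Fraction_Field.Fract a u" "a \<in> carrier R" "u \<in> carrier R - p"
    by blast
  have "- x = Fraction_Field.Fract (- a) u" using x by simp
  then show "- x \<in> ?S" using uc[OF x(2)] x(3) by blast
  fix y assume "y \<in> ?S"
  then obtain b v where y: "y = Fraction_Field.Fract b v" "b \<in> carrier R" "v \<in> carrier R - p"
    by blast
  have "x + y = Fraction_Field.Fract (a * v + b * u) (u * v)"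
    unfolding x(1) y(1) using nz x(3) y(3) by (intro add_fract) simp_all
  moreover have "a * v + b * u \<in> carrier R" using x y by (intro ac mc) auto
  ultimately show "x + y \<in> ?S" using mp[OF x(3) y(3)] by blast
  have "x * y = Fraction_Field.Fract (a * b) (u * v)" using x y by simp
  then show "x * y \<in> ?S" using mp[OF x(3) y(3)] mc[OF x(2) y(2)] by blast
qed

lemma Var_in_mpoly_ring: "i \<in> V \<Longrightarrow> Var i \<in> carrier (mpoly_ring V)"
  by (simp add: mpoly_ring_def Var_def)

lemma ideal_edge_ideal:
  assumes "pair_wf_digraph G"
  shows "ideal (edge_ideal G :: 'k::field mpoly set) (mpoly_ring (pverts G))"
proof -
  interpret cring "mpoly_ring (pverts G) :: 'k mpoly ring" by (rule cring_mpoly_ring)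
  have mult: "monoid.mult (mpoly_ring (pverts G) :: 'k mpoly ring) = (*)" by (simp add: mpoly_ring_def)
  have "{Var i * Var j |i j. (i, j) \<in> parcs G}
      \<subseteq> carrier (mpoly_ring (pverts G) :: 'k mpoly ring)"
    using pair_wf_digraph.in_arcsD1[OF assms] pair_wf_digraph.in_arcsD2[OF assms]
    by (auto intro!: m_closed[unfolded mult] Var_in_mpoly_ring)
  then show ?thesis unfolding edge_ideal_def by (rule genideal_ideal)
qed

lemma cyc_nbhd_sym: "i \<in> {1..n} \<Longrightarrow> j \<in> cyc_nbhd n r i \<Longrightarrow> i \<in> cyc_nbhd n r j"
  by (auto simp: cyc_nbhd_def cong_iff_dvd_diff dvd_diff_commute algebra_simps intro!: bexI)

lemma pair_graph_G_graph: "pair_graph (G_graph n r)"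
proof -
  have "finite (parcs (G_graph n r))"
    by (rule finite_subset[of _ "{1..n} \<times> {1..n}"]) (auto simp: G_graph_def)
  then show ?thesis
    by unfold_locales
       (auto simp: G_graph_def symmetric_def sym_def dest: cyc_nbhd_sym[rotated])
qed

lemma G_graph_arc_iff:
  assumes "1 \<le> i" "i < j" "j \<le> n"
  shows "(i, j) \<in> parcs (G_graph n r) \<longleftrightarrow> r + 1 \<le> j - i \<and> int (j - i) \<le> int n - (int r + 1)"
proof -
  obtain k where k: "j = i + k" "0 < k" "k < n"
    using assms that[of "j - i"] by linarith
  have "j \<in> cyc_nbhd n r i \<longleftrightarrow> k \<le> r \<or> n \<le> k + r"
  proof
    assume "j \<in> cyc_nbhd n r i"
    then obtain d where d: "1 \<le> d" "d \<le> r"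
      and dd: "int n dvd int k + int d \<or> int n dvd int k - int d"
      by (auto simp: cyc_nbhd_def cong_iff_dvd_diff k(1))
    from dd show "k \<le> r \<or> n \<le> k + r"
    proof
      assume "int n dvd int k + int d"
      then have "int n \<le> int k + int d" by (rule zdvd_imp_le) (use k in simp)
      then show ?thesis using d by linarith
    next
      assume dvd: "int n dvd int k - int d"
      have "\<not> d < k"
      proof
        assume "d < k"
        with zdvd_imp_le[OF dvd] k(3) d(1) show False by simp
      qed
      then show ?thesis using d by linarith
    qed
  next
    assume "k \<le> r \<or> n \<le> k + r"
    then show "j \<in> cyc_nbhd n r i"
    proof
      assume "k \<le> r"
      then have "k \<in> {1..r}" using k by simp
      moreover have "[int j = int i + int k] (mod int n)" by (simp add: k(1))
      moreover have "j \<in> {1..n}" using assms by simp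
      ultimately show ?thesis unfolding cyc_nbhd_def by blast
    next
      assume "n \<le> k + r"
      then have "n - k \<in> {1..r}" using k(2,3) by auto
      moreover have "[int j = int i - int (n - k)] (mod int n)"
        using k(3) by (simp add: cong_iff_dvd_diff k(1) of_nat_diff)
      moreover have "j \<in> {1..n}" using assms by simp
      ultimately show ?thesis unfolding cyc_nbhd_def by blast
    qed
  qed
  moreover have "(i, j) \<in> parcs (G_graph n r) \<longleftrightarrow> j \<notin> cyc_nbhd n r i"
    using assms by (simp add: G_graph_def)
  moreover have "j - i = k" by (simp add: k(1))
  moreover have "\<not> (k \<le> r \<or> n \<le> k + r) \<longleftrightarrow> r + 1 \<le> k \<and> int k \<le> int n - (int r + 1)"
    by linarith
  ultimately show ?thesis by simp
qed

end

theory Submission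
  imports Defs "HOL-Combinatorics.Orbits"
begin

text \<open>
  A monomial \<open>x\<^sup>a\<close> lies in \<open>I\<^sup>t\<close> iff the blow-up of the graph with \<open>a\<^sub>i\<close> copies of \<open>x\<^sub>i\<close> has a
  matching with \<open>t\<close> edges, and it lies in the \<open>s\<close>-th symbolic power iff \<open>\<bar>a\<bar> - a(F) \<ge> s\<close> for
  every independent set \<open>F\<close>. Averaging the latter over the \<open>n\<close> independent sets of \<open>r + 1\<close>
  consecutive vertices gives \<open>(n - r - 1)\<bar>a\<bar> \<ge> ns\<close>, so \<open>\<bar>a\<bar> > 2t\<close> as soon as
  \<open>s/t > 2(n - r - 1)/n\<close>; moreover \<open>s \<ge> t\<close> then. The non-neighbours of \<open>x\<^sub>i\<close> form the two independent
  sets \<open>{x\<^bsub>i-r\<^esub>, \<dots>, x\<^sub>i}\<close> and \<open>{x\<^sub>i, \<dots>, x\<^bsub>i+r\<^esub>}\<close>, so every vertex has a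
  neighbour on every odd cycle. Hence any two odd cycles of a fractional matching can be traded for a matching of
  their union, and a fractional matching of weight \<open>min(s, \<bar>a\<bar>/2)\<close>, which exists by Hall's
  theorem, yields \<open>t\<close> disjoint edges. Conversely independent sets have at most \<open>r + 1\<close> vertices,
  so the monomials \<open>(x\<^sub>1 \<cdots> x\<^sub>n)\<^bsup>2k\<^esup>\<close> show that the bound is attained in the limit.
\<close>

section \<open>Matchings\<close>

text \<open>Induction on \<open>card I\<close>. If a nonempty proper \<open>J\<close> is tight,
  \<open>J\<close> and its complement are matched separately, the latter into what \<open>J\<close>
  does not reach. Otherwise every such \<open>J\<close> has a spare element, so one index may take
  any \<open>y\<close> without spoiling Hall's condition.\<close>

lemma Hall_marriage:
  fixes A :: "'i \<Rightarrow> 'b set"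
  assumes "finite I" "\<And>i. i \<in> I \<Longrightarrow> finite (A i)"
    and "\<And>J. J \<subseteq> I \<Longrightarrow> card J \<le> card (\<Union> (A ` J))"
  shows "\<exists>f. inj_on f I \<and> (\<forall>i \<in> I. f i \<in> A i)"
  using assms
proof (induction "card I" arbitrary: I A rule: less_induct)
  case less
  have fin: "finite (\<Union> (A ` J))" if "J \<subseteq> I" for J
    using that less.prems(1,2) by (meson finite_UN_I finite_subset subsetD)
  show ?case
  proof (cases "\<exists>J. J \<noteq> {} \<and> J \<subset> I \<and> card (\<Union> (A ` J)) = card J")
    case True
    then obtain J where J: "J \<noteq> {}" "J \<subset> I" "card (\<Union> (A ` J)) = card J" by blast
    have finJ: "finite J" using J(2) less.prems(1) by (meson finite_subset psubset_imp_subset)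
    have "\<exists>f. inj_on f J \<and> (\<forall>i \<in> J. f i \<in> A i)"
      using psubset_card_mono[OF less.prems(1) J(2)] finJ
      by (rule less.hyps) (use less.prems J(2) in auto)
    then obtain f where f: "inj_on f J" "\<forall>i \<in> J. f i \<in> A i" by blast
    define B where "B i = A i - \<Union> (A ` J)" for i
    have "\<exists>g. inj_on g (I - J) \<and> (\<forall>i \<in> I - J. g i \<in> B i)"
    proof (rule less.hyps)
      show "card (I - J) < card I"
        using J(1,2) less.prems(1) by (intro psubset_card_mono) auto
      fix K assume K: "K \<subseteq> I - J"
      have finK: "finite K" using K less.prems(1) by (meson finite_Diff finite_subset)
      \<comment> \<open>Hall's condition for \<open>K \<union> J\<close> minus the tight equation
        for \<open>J\<close> is the condition for \<open>K\<close> in the remainder.\<close>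
      have "card K + card J = card (K \<union> J)"
        using K finK finJ by (subst card_Un_disjoint) auto
      also have "\<dots> \<le> card (\<Union> (A ` (K \<union> J)))"
        using K J(2) by (intro less.prems(3)) auto
      also have "\<Union> (A ` (K \<union> J)) = \<Union> (B ` K) \<union> \<Union> (A ` J)"
        by (auto simp: B_def)
      also have "card \<dots> \<le> card (\<Union> (B ` K)) + card J"
        using card_Un_le[of "\<Union> (B ` K)" "\<Union> (A ` J)"] J(3) by simp
      finally show "card K \<le> card (\<Union> (B ` K))" by simp
    qed (use less.prems in \<open>auto simp: B_def\<close>)
    then obtain g where g: "inj_on g (I - J)" "\<forall>i \<in> I - J. g i \<in> B i" by blast
    define h where "h i = (if i \<in> J then f i else g i)" for i
    have "inj_on h I"
    proof (rule inj_onI)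
      fix i j assume ij: "i \<in> I" "j \<in> I" "h i = h j"
      have "f k \<noteq> g l" if "k \<in> J" "l \<in> I - J" for k l
        using f(2) g(2) that by (auto simp: B_def)
      then show "i = j"
        using ij f(1) g(1) unfolding h_def inj_on_def by (metis DiffI)
    qed
    moreover have "\<forall>i \<in> I. h i \<in> A i"
      using f(2) g(2) by (auto simp: h_def B_def)
    ultimately show ?thesis by blast
  next
    case False
    show ?thesis
    proof (cases "I = {}")
      case nonempty: False
      then obtain i where i: "i \<in> I" by blast
      have "card {i} \<le> card (A i)" using less.prems(3)[of "{i}"] i by simp
      then obtain y where y: "y \<in> A i" by fastforce
      have "\<exists>g. inj_on g (I - {i}) \<and> (\<forall>j \<in> I - {i}. g j \<in> A j - {y})"
      proof (rule less.hyps)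
        show "card (I - {i}) < card I" using i less.prems(1) by (meson card_Diff1_less)
        fix J assume J: "J \<subseteq> I - {i}"
        show "card J \<le> card (\<Union>j \<in> J. A j - {y})"
        proof (cases "J = {}")
          case False
          have "J \<subset> I" using J i by blast
          with False \<open>\<not> (\<exists>J. _ J)\<close> have "card (\<Union> (A ` J)) \<noteq> card J" by blast
          moreover have "card J \<le> card (\<Union> (A ` J))"
            using \<open>J \<subset> I\<close> by (intro less.prems(3)) auto
          moreover have "(\<Union>j \<in> J. A j - {y}) = \<Union> (A ` J) - {y}" by blast
          ultimately show ?thesis
            using card_Diff1_le[of "\<Union> (A ` J)" y] card_Diff_singleton_if[of "\<Union> (A ` J)" y]
            by (auto split: if_splits)
        qed simp
      qed (use less.prems in auto)
      then obtain g where g: "inj_on g (I - {i})" "\<forall>j \<in> I - {i}. g j \<in> A j - {y}" by blast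
      have "inj_on (g(i := y)) I"
        using g by (simp add: inj_on_def) (metis DiffI singletonD)
      moreover have "\<forall>j \<in> I. (g(i := y)) j \<in> A j" using g y by auto
      ultimately show ?thesis by blast
    qed simp
  qed
qed

section \<open>Independent sets, perfect matchings and factor-critical blocks\<close>

definition independent :: "('a \<times> 'a) set \<Rightarrow> 'a set \<Rightarrow> bool" where
  "independent E F \<longleftrightarrow> (\<forall>u \<in> F. \<forall>v \<in> F. (u, v) \<notin> E)"

text \<open>The sides may overlap and need not lie inside \<open>B\<close>, so windows of the cycle
  can serve directly.\<close>

definition bipartite :: "('a \<times> 'a) set \<Rightarrow> 'a set \<Rightarrow> bool" where
  "bipartite E B \<longleftrightarrow> (\<exists>P Q. independent E P \<and> independent E Q \<and> B \<subseteq> P \<union> Q)"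

lemma independent_subset: "independent E F \<Longrightarrow> F' \<subseteq> F \<Longrightarrow> independent E F'"
  unfolding independent_def by blast

inductive matchable :: "('a \<times> 'a) set \<Rightarrow> 'a set \<Rightarrow> bool" for E where
  empty: "matchable E {}"
| insert: "matchable E S \<Longrightarrow> (u, v) \<in> E \<Longrightarrow> u \<noteq> v \<Longrightarrow> u \<notin> S \<Longrightarrow> v \<notin> S
    \<Longrightarrow> matchable E (insert u (insert v S))"

lemma finite_matchable: "matchable E S \<Longrightarrow> finite S"
  by (induction rule: matchable.induct) auto

lemma even_card_matchable: "matchable E S \<Longrightarrow> even (card S)"
  by (induction rule: matchable.induct) (auto simp: finite_matchable)

lemma matchable_Un:
  assumes "matchable E S" "matchable E T" "S \<inter> T = {}"
  shows "matchable E (S \<union> T)"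
  using assms
proof (induction rule: matchable.induct)
  case (insert S u v)
  then have "matchable E (insert u (insert v (S \<union> T)))"
    by (intro matchable.insert) auto
  then show ?case by simp
qed simp

text \<open>Every second step of the walk is taken as a matching edge: \<open>g a\<close> with
  \<open>g (a + 1)\<close>, and so on.\<close>

lemma matchable_walk:
  assumes "inj_on g {a..<a + 2 * k}" "\<And>i. i \<in> {a..<a + 2 * k} \<Longrightarrow> (g i, g (Suc i)) \<in> E"
  shows "matchable E (g ` {a..<a + 2 * k})"
  using assms
proof (induction k)
  case (Suc k)
  have "matchable E (insert (g (a + 2 * k)) (insert (g (Suc (a + 2 * k))) (g ` {a..<a + 2 * k})))"
  proof (rule matchable.insert)
    show "matchable E (g ` {a..<a + 2 * k})"
      using Suc.prems by (intro Suc.IH) (auto elim: inj_on_subset)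
    show "g (a + 2 * k) \<noteq> g (Suc (a + 2 * k))"
      using inj_onD[OF Suc.prems(1), of "a + 2 * k" "Suc (a + 2 * k)"] by auto
    show "g (a + 2 * k) \<notin> g ` {a..<a + 2 * k}"
      using inj_onD[OF Suc.prems(1), of "a + 2 * k"] by force
    show "g (Suc (a + 2 * k)) \<notin> g ` {a..<a + 2 * k}"
      using inj_onD[OF Suc.prems(1), of "Suc (a + 2 * k)"] by force
  qed (use Suc.prems(2) in auto)
  also have "insert (g (a + 2 * k)) (insert (g (Suc (a + 2 * k))) (g ` {a..<a + 2 * k}))
      = g ` {a..<a + 2 * Suc k}"
    by (auto simp: image_iff less_Suc_eq)
  finally show ?case .
qed (simp add: matchable.empty)

text \<open>Each matching edge has one end in \<open>P\<close> and the other in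
  \<open>Q\<close>.\<close>

lemma card_matchable_bipartition:
  assumes "matchable E S" "sym E" "independent E P" "independent E Q" "S \<subseteq> P \<union> Q" "P \<inter> Q = {}"
  shows "card (S \<inter> P) = card (S \<inter> Q)"
  using assms
proof (induction rule: matchable.induct)
  case (insert S u v)
  have fin: "finite S" by (rule finite_matchable) fact
  have "u \<in> P \<and> v \<in> Q \<or> u \<in> Q \<and> v \<in> P"
    using insert.prems insert.hyps by (auto simp: independent_def)
  then show ?case
    using insert fin by (auto simp: Int_insert_left)
qed simp

definition factor_critical :: "('a \<times> 'a) set \<Rightarrow> 'a set \<Rightarrow> bool" where
  "factor_critical E B \<longleftrightarrow> (\<forall>b \<in> B. matchable E (B - {b}))"

text \<open>Deleting a vertex of one side leaves sides of equal size, so a nonempty side is larger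
  by one than the other. Hence one side is empty and the other is a single vertex.\<close>

lemma factor_critical_not_bipartite:
  assumes B: "factor_critical E B" "2 \<le> card B" and "sym E"
  shows "\<not> bipartite E B"
proof
  assume "bipartite E B"
  then obtain P' Q' where PQ': "independent E P'" "independent E Q'" "B \<subseteq> P' \<union> Q'"
    unfolding bipartite_def by blast
  \<comment> \<open>The overlap of the given sides is assigned to \<open>P\<close>, which makes the
    sides disjoint.\<close>
  define P Q where "P = B \<inter> P'" and "Q = B - P'"
  have "P \<subseteq> P'" "Q \<subseteq> Q'" using PQ'(3) by (auto simp: P_def Q_def)
  then have "independent E P" "independent E Q"
    using PQ'(1,2) by (blast intro: independent_subset)+
  moreover have "P \<union> Q = B" "P \<inter> Q = {}" by (auto simp: P_def Q_def)
  ultimately have PQ: "independent E P" "independent E Q" "P \<union> Q = B" "P \<inter> Q = {}" .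
  have fin: "finite B" using B(2) by (auto intro: card_ge_0_finite)
  then have finPQ: "finite P" "finite Q" using PQ(3) by auto
  have P: "card P = Suc (card Q)" if "p \<in> P" for p
  proof -
    have "card ((B - {p}) \<inter> P) = card ((B - {p}) \<inter> Q)"
      using B(1) that PQ
      by (intro card_matchable_bipartition[of E] \<open>sym E\<close>) (auto simp: factor_critical_def)
    moreover have "(B - {p}) \<inter> P = P - {p}" "(B - {p}) \<inter> Q = Q" using PQ that by auto
    ultimately show ?thesis using that finPQ(1) card_Suc_Diff1 by metis
  qed
  have Q: "card Q = Suc (card P)" if "q \<in> Q" for q
  proof -
    have "card ((B - {q}) \<inter> P) = card ((B - {q}) \<inter> Q)"
      using B(1) that PQ
      by (intro card_matchable_bipartition[of E] \<open>sym E\<close>) (auto simp: factor_critical_def)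
    moreover have "(B - {q}) \<inter> P = P" "(B - {q}) \<inter> Q = Q - {q}" using PQ that by auto
    ultimately show ?thesis using that finPQ(2) card_Suc_Diff1 by metis
  qed
  have "card B = card P + card Q" using PQ finPQ card_Un_disjoint by metis
  moreover have "P = {} \<or> Q = {}" using P Q by fastforce
  moreover have "card P = Suc (card Q) \<or> card Q = Suc (card P)"
  proof -
    have "B \<noteq> {}" using B(2) by auto
    then obtain b where "b \<in> P \<or> b \<in> Q" using PQ(3) by blast
    then show ?thesis using P Q by blast
  qed
  ultimately show False using B(2) by auto
qed

text \<open>An orbit is a closed walk through each of its vertices once. Alternate steps match an
  even orbit; in an odd one, the walk starting at the deleted vertex leaves an even walk.
  Irreflexivity excludes orbits of length one.\<close>

lemma cyclic_on_matchable:
  assumes "cyclic_on f C" and E: "\<And>x. x \<in> C \<Longrightarrow> (x, f x) \<in> E" and "irrefl E"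
  shows "matchable E C \<or> factor_critical E C \<and> 2 \<le> card C"
proof -
  have walk: "\<exists>g. g 0 = x \<and> inj_on g {0..<card C} \<and> g ` {0..<card C} = C
      \<and> (\<forall>i. (g i, g (Suc i)) \<in> E)" if x: "x \<in> C" for x
  proof -
    have orb: "orbit f x = C" using assms(1) x by (rule orbit_cyclic_eq3)
    then have xo: "x \<in> orbit f x" using x by simp
    let ?g = "\<lambda>i. (f ^^ i) x"
    let ?d = "funpow_dist1 f x x"
    have "C = ?g ` {0..<?d}" using orbit_conv_funpow_dist1[OF xo] orb by simp
    moreover have inj: "inj_on ?g {0..<?d}" by (rule inj_on_funpow_dist1[OF xo])
    ultimately have "card C = ?d" by (simp add: card_image)
    moreover have "(?g i, ?g (Suc i)) \<in> E" for i
      using E[OF cyclic_on_funpow_in[OF assms(1) x]] by simp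
    ultimately show ?thesis using \<open>C = _\<close> inj by (intro exI[of _ ?g]) simp
  qed
  have fin: "finite C" by (rule finite_cyclic_on) fact
  show ?thesis
  proof (cases "even (card C)")
    case True
    then obtain k where k: "card C = 2 * k" by blast
    from assms(1) obtain x where "x \<in> C" by (auto simp: cyclic_on_def)
    then obtain g where "inj_on g {0..<card C}" "g ` {0..<card C} = C"
      "\<forall>i. (g i, g (Suc i)) \<in> E" using walk by blast
    then have "matchable E C" using matchable_walk[of g 0 k E] k by simp
    then show ?thesis ..
  next
    case False
    then obtain k where k: "card C = Suc (2 * k)" by (metis oddE Suc_eq_plus1)
    have "factor_critical E C"
      unfolding factor_critical_def
    proof
      fix x assume "x \<in> C"
      then obtain g where g: "g 0 = x" "inj_on g {0..<card C}" "g ` {0..<card C} = C"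
        "\<forall>i. (g i, g (Suc i)) \<in> E" using walk by blast
      have "matchable E (g ` {1..<1 + 2 * k})"
        using g(2,4) k by (intro matchable_walk) (auto elim: inj_on_subset)
      moreover have "{0..<card C} = insert 0 {1..<1 + 2 * k}" using k by auto
      then have "C - {x} = g ` {1..<1 + 2 * k}"
        using g(1-3) by (auto simp: inj_on_def)
      ultimately show "matchable E (C - {x})" by simp
    qed
    moreover have "card C \<noteq> 1"
    proof
      assume "card C = 1"
      then obtain x where "C = {x}" by (auto simp: card_1_singleton_iff)
      then have "f x = x" using cyclic_on_inI[OF assms(1), of x] by simp
      then show False using E[of x] \<open>C = {x}\<close> \<open>irrefl E\<close> by (auto simp: irrefl_def)
    qed
    then have "2 \<le> card C" using k by simp
    ultimately show ?thesis by blast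
  qed
qed

text \<open>Deleting the ends of the joining edge leaves two blocks with perfect matchings; the edge
  itself covers the ends.\<close>

lemma factor_critical_join:
  assumes "factor_critical E B" "factor_critical E B'" "B \<inter> B' = {}"
    "b \<in> B" "b' \<in> B'" "(b, b') \<in> E"
  shows "matchable E (B \<union> B')"
proof -
  have "matchable E ((B - {b}) \<union> (B' - {b'}))"
    using assms by (intro matchable_Un) (auto simp: factor_critical_def)
  then have "matchable E (insert b (insert b' ((B - {b}) \<union> (B' - {b'}))))"
    using assms by (intro matchable.insert) auto
  moreover have "insert b (insert b' ((B - {b}) \<union> (B' - {b'}))) = B \<union> B'"
    using assms by blast
  ultimately show ?thesis by simp
qed

text \<open>Orbits of even length are matchable, those of odd length are factor-critical. Two
  factor-critical blocks are non-bipartite, hence joined by an edge, and merge into a matchable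
  set; so at most one odd block survives.\<close>

lemma cyclic_cover_near_matchable:
  assumes "finite \<C>" "\<And>C. C \<in> \<C> \<Longrightarrow> cyclic_on f C" "disjoint \<C>"
    "\<And>C x. C \<in> \<C> \<Longrightarrow> x \<in> C \<Longrightarrow> (x, f x) \<in> E" "irrefl E" "sym E"
    and joined: "\<And>B B'. B \<subseteq> \<Union>\<C> \<Longrightarrow> B' \<subseteq> \<Union>\<C> \<Longrightarrow> \<not> bipartite E B \<Longrightarrow> \<not> bipartite E B'
      \<Longrightarrow> \<exists>b \<in> B. \<exists>b' \<in> B'. (b, b') \<in> E"
  shows "\<exists>S B. S \<union> B = \<Union>\<C> \<and> S \<inter> B = {} \<and> matchable E S
    \<and> (B = {} \<or> factor_critical E B \<and> 2 \<le> card B)"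
  using assms
proof (induction rule: finite_induct)
  case empty
  then show ?case by (auto intro: matchable.empty)
next
  case (insert C \<C>)
  have "\<exists>S B. S \<union> B = \<Union>\<C> \<and> S \<inter> B = {} \<and> matchable E S
    \<and> (B = {} \<or> factor_critical E B \<and> 2 \<le> card B)"
    using insert.prems insert.hyps
    by (intro insert.IH) (auto simp: pairwise_insert Sup_insert le_supI2)
  then obtain S B where SB: "S \<union> B = \<Union>\<C>" "S \<inter> B = {}" "matchable E S"
    "B = {} \<or> factor_critical E B \<and> 2 \<le> card B" by blast
  have disj: "C \<inter> \<Union>\<C> = {}"
    using insert.prems(2) insert.hyps(2) by (auto simp: pairwise_insert disjnt_def)
  have "matchable E C \<or> factor_critical E C \<and> 2 \<le> card C"
    using insert.prems by (intro cyclic_on_matchable[of f]) auto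
  then consider "matchable E C" | "factor_critical E C" "2 \<le> card C" "B = {}"
    | "factor_critical E C" "2 \<le> card C" "factor_critical E B" "2 \<le> card B"
    using SB(4) by blast
  then show ?case
  proof cases
    case 1
    then have "matchable E (S \<union> C)" using SB disj by (intro matchable_Un) auto
    moreover have "(S \<union> C) \<union> B = \<Union> (insert C \<C>)" "(S \<union> C) \<inter> B = {}"
      using SB disj by auto
    ultimately show ?thesis using SB(4) by blast
  next
    case 2
    then show ?thesis using SB disj
      by (intro exI[of _ S] exI[of _ C]) auto
  next
    case 3
    then have "\<exists>b \<in> B. \<exists>c \<in> C. (b, c) \<in> E"
      using insert.prems(5) SB(1)
      by (intro insert.prems(6)) (auto dest: factor_critical_not_bipartite)
    then obtain b c where "b \<in> B" "c \<in> C" "(b, c) \<in> E" by blast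
    then have "matchable E (B \<union> C)"
      using 3 SB disj by (intro factor_critical_join[of E B C b c]) auto
    then have "matchable E (S \<union> (B \<union> C))"
      using SB disj by (intro matchable_Un[of E S "B \<union> C"]) auto
    moreover have "(S \<union> (B \<union> C)) \<union> {} = \<Union> (insert C \<C>)"
      using SB by auto
    ultimately show ?thesis by blast
  qed
qed

text \<open>The Hall condition is that of the bipartite double cover, where a perfect matching is a
  permutation moving every vertex to a neighbour.\<close>

lemma near_matchable:
  assumes "finite X" "sym E" "irrefl E"
    and hall: "\<And>J. J \<subseteq> X \<Longrightarrow> card J \<le> card {y \<in> X. \<exists>x \<in> J. (x, y) \<in> E}"
    and joined: "\<And>B B'. B \<subseteq> X \<Longrightarrow> B' \<subseteq> X \<Longrightarrow> \<not> bipartite E B \<Longrightarrow> \<not> bipartite E B'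
      \<Longrightarrow> \<exists>b \<in> B. \<exists>b' \<in> B'. (b, b') \<in> E"
  shows "\<exists>S \<subseteq> X. matchable E S \<and> card X \<le> card S + 1"
proof -
  define A where "A x = {y \<in> X. (x, y) \<in> E}" for x
  have "\<exists>f. inj_on f X \<and> (\<forall>x \<in> X. f x \<in> A x)"
  proof (rule Hall_marriage)
    fix J assume "J \<subseteq> X"
    moreover have "\<Union> (A ` J) = {y \<in> X. \<exists>x \<in> J. (x, y) \<in> E}" by (auto simp: A_def)
    ultimately show "card J \<le> card (\<Union> (A ` J))" using hall by simp
  qed (use assms(1) in \<open>auto simp: A_def\<close>)
  then obtain f where f: "inj_on f X" "\<forall>x \<in> X. f x \<in> A x" by blast
  \<comment> \<open>\<open>permutes\<close> speaks of a map on the whole type that fixes everything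
    outside \<open>X\<close>.\<close>
  define \<sigma> where "\<sigma> x = (if x \<in> X then f x else x)" for x
  have "inj_on \<sigma> X" using f(1) by (simp add: \<sigma>_def inj_on_def)
  moreover have "\<sigma> ` X \<subseteq> X" using f(2) by (auto simp: \<sigma>_def A_def)
  ultimately have "bij_betw \<sigma> X X"
    using assms(1) by (simp add: bij_betw_def endo_inj_surj)
  then have "\<sigma> permutes X" by (rule bij_imp_permutes) (simp add: \<sigma>_def)
  from permutes_decompose[OF this assms(1)] obtain \<C> where
    C: "\<forall>c \<in> \<C>. cyclic_on \<sigma> c" "\<Union>\<C> = X" "\<forall>c1 \<in> \<C>. \<forall>c2 \<in> \<C>. c1 \<noteq> c2 \<longrightarrow> c1 \<inter> c2 = {}"
    by blast
  have "(x, \<sigma> x) \<in> E" if "x \<in> X" for x using f(2) that by (simp add: \<sigma>_def A_def)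
  moreover have "finite \<C>" using C(2) assms(1) by (simp add: finite_UnionD)
  ultimately have "\<exists>S B. S \<union> B = \<Union>\<C> \<and> S \<inter> B = {} \<and> matchable E S
      \<and> (B = {} \<or> factor_critical E B \<and> 2 \<le> card B)"
    using C assms by (intro cyclic_cover_near_matchable[of \<C> \<sigma>]) (auto simp: pairwise_def disjnt_def)
  then obtain S B where SB: "S \<union> B = X" "S \<inter> B = {}" "matchable E S"
    "B = {} \<or> factor_critical E B \<and> 2 \<le> card B" using C(2) by auto
  show ?thesis
  proof (cases "B = {}")
    case True
    then show ?thesis using SB by auto
  next
    case False
    \<comment> \<open>Omitting one vertex of the odd block costs exactly the 1 allowed in the
      conclusion.\<close>
    then obtain b where b: "b \<in> B" by blast
    then have "matchable E (B - {b})" using SB(4) by (auto simp: factor_critical_def)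
    then have "matchable E (S \<union> (B - {b}))" using SB by (intro matchable_Un) auto
    moreover have "S \<union> (B - {b}) = X - {b}" using SB b by auto
    ultimately have "matchable E (X - {b})" by simp
    moreover have "card X \<le> card (X - {b}) + 1"
      using card_Suc_Diff1[of X b] b SB(1) assms(1) by auto
    ultimately show ?thesis by blast
  qed
qed

section \<open>Matchings in blow-ups\<close>

text \<open>The monomial \<open>x^m\<close> is divisible by a product of \<open>t\<close> edge
  generators, repetitions allowed. The rule \<open>zero\<close> starts from an arbitrary
  \<open>m\<close>, which supplies the cofactor.\<close>

inductive edge_multiple :: "('a \<times> 'a) set \<Rightarrow> nat \<Rightarrow> ('a \<Rightarrow>\<^sub>0 nat) \<Rightarrow> bool" for E where
  zero: "edge_multiple E 0 m"
| Suc: "edge_multiple E t m \<Longrightarrow> (i, j) \<in> E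
    \<Longrightarrow> edge_multiple E (Suc t) (m + Poly_Mapping.single i 1 + Poly_Mapping.single j 1)"

text \<open>The vertices outside \<open>F \<union> N(F)\<close> miss a vertex of \<open>F\<close>, so they split into two independent
  sets, each of which can be added to \<open>F\<close>. Averaging the two resulting cover inequalities gives
  the claim.\<close>

lemma weighted_Hall_deficiency:
  fixes w :: "'a \<Rightarrow> nat"
  assumes "finite V" "T \<subseteq> V" "sym E"
    and nonnbr: "\<And>v. v \<in> V \<Longrightarrow> bipartite E {u \<in> V. (v, u) \<notin> E}"
    and cover: "\<And>F. F \<subseteq> V \<Longrightarrow> independent E F \<Longrightarrow> s \<le> sum w (V - F)"
  shows "sum w T \<le> (sum w V - 2 * s) + sum w {v \<in> V. \<exists>u \<in> T. (u, v) \<in> E}"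
proof -
  define N where "N T = {v \<in> V. \<exists>u \<in> T. (u, v) \<in> E}" for T
  \<comment> \<open>\<open>F\<close> consists of the vertices of \<open>T\<close> without a
    neighbour in \<open>T\<close>; the rest, \<open>T \<inter> N T\<close>, is counted on both sides
    of the claim.\<close>
  define F where "F = T - N T"
  have finN: "finite (N U)" for U using assms(1) by (simp add: N_def)
  have finT: "finite T" using assms(1,2) by (rule rev_finite_subset)
  have FV: "F \<subseteq> V" and finF: "finite F" using assms(2) finT by (auto simp: F_def)
  have indF: "independent E F"
    using FV by (auto simp: independent_def F_def N_def)
  have NF: "N F \<subseteq> N T - T"
    using \<open>sym E\<close> FV by (auto simp: F_def N_def dest: symD)
  have T: "sum w T = sum w F + sum w (T \<inter> N T)"
    using finT unfolding F_def by (metis sum.Int_Diff add.commute)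
  have "sum w (N F) + sum w (T \<inter> N T) = sum w (N F \<union> (T \<inter> N T))"
    using NF finN finT by (intro sum.union_disjoint[symmetric]) auto
  also have "\<dots> \<le> sum w (N T)"
    using NF finN by (intro sum_mono2) auto
  finally have NT: "sum w (N F) + sum w (T \<inter> N T) \<le> sum w (N T)" .
  have "sum w F \<le> (sum w V - 2 * s) + sum w (N F)"
  proof (cases "F = {}")
    case False
    then obtain f where f: "f \<in> F" by blast
    obtain P Q where PQ: "independent E P" "independent E Q" "{u \<in> V. (f, u) \<notin> E} \<subseteq> P \<union> Q"
      using nonnbr[of f] f FV unfolding bipartite_def by blast
    \<comment> \<open>No vertex of \<open>W\<close> is adjacent to \<open>F\<close>, so any
      independent part of \<open>W\<close> can be joined to \<open>F\<close>.\<close>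
    define W where "W = V - F - N F"
    have finW: "finite W" using assms(1) by (simp add: W_def)
    have WPQ: "W \<subseteq> P \<union> Q" using PQ(3) f by (auto simp: W_def N_def)
    have ind: "independent E (F \<union> (W \<inter> U))" if "independent E U" for U
      using that indF \<open>sym E\<close> by (auto simp: independent_def W_def N_def dest: symD)
    have V: "sum w V = sum w F + sum w (N F) + sum w W"
    proof -
      have "V = (F \<union> N F) \<union> W" using FV by (auto simp: W_def N_def)
      then have "sum w V = sum w ((F \<union> N F) \<union> W)" by simp
      also have "\<dots> = sum w (F \<union> N F) + sum w W"
        using finF finN finW by (intro sum.union_disjoint) (auto simp: W_def)
      also have "sum w (F \<union> N F) = sum w F + sum w (N F)"
        using finF finN NF by (intro sum.union_disjoint) (auto simp: F_def)
      finally show ?thesis .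
    qed
    have bound: "s + sum w (W \<inter> U) \<le> sum w (N F) + sum w W" if "independent E U" for U
    proof -
      have "s \<le> sum w (V - (F \<union> (W \<inter> U)))"
        using FV by (intro cover ind that) (auto simp: W_def)
      also have "\<dots> = sum w V - sum w (F \<union> (W \<inter> U))"
        using assms(1) finF FV by (intro sum_diff_nat) (auto simp: W_def)
      also have "sum w (F \<union> (W \<inter> U)) = sum w F + sum w (W \<inter> U)"
        using finF finW by (intro sum.union_disjoint) (auto simp: W_def)
      finally have "s \<le> sum w (N F) + sum w W - sum w (W \<inter> U)" using V by simp
      moreover have "sum w (W \<inter> U) \<le> sum w W" using finW by (intro sum_mono2) auto
      ultimately show ?thesis by linarith
    qed
    have "sum w W \<le> sum w ((W \<inter> P) \<union> (W \<inter> Q))"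
      using WPQ finW by (intro sum_mono2) auto
    also have "\<dots> \<le> sum w (W \<inter> P) + sum w (W \<inter> Q)"
      using finW by (simp add: sum_Un_nat)
    finally have "sum w W \<le> sum w (W \<inter> P) + sum w (W \<inter> Q)" .
    then show ?thesis using bound[OF PQ(1)] bound[OF PQ(2)] V by linarith
  qed simp
  then show ?thesis using T NT unfolding N_def by linarith
qed

text \<open>The apex \<^term>\<open>None\<close> is adjacent to every vertex; its copies in the blow-up absorb the weight
  in excess of \<open>2s\<close>, so that a near-perfect matching of the cone still contains \<open>s\<close> edges
  avoiding the apex.\<close>

fun cone_adj :: "('a \<times> 'a) set \<Rightarrow> 'a option \<Rightarrow> 'a option \<Rightarrow> bool" where
  "cone_adj E (Some u) (Some v) \<longleftrightarrow> (u, v) \<in> E"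
| "cone_adj E None None \<longleftrightarrow> False"
| "cone_adj E _ _ \<longleftrightarrow> True"

text \<open>A vertex is a base vertex with a copy number. Copies are unlimited here; the weights
  enter through the finite vertex set on which the relation is used.\<close>

definition cone_blowup :: "('a \<times> 'a) set \<Rightarrow> (('a option \<times> nat) \<times> ('a option \<times> nat)) set" where
  "cone_blowup E = {(x, y). cone_adj E (fst x) (fst y)}"

text \<open>A matching edge at the apex uses up one apex copy. All other edges project to
  \<open>E\<close>, and the copies of \<open>i\<close> that they use fit into the exponent of
  \<open>i\<close>.\<close>

lemma edge_multiple_of_matchable:
  assumes "matchable (cone_blowup E) S" "irrefl E"
    "\<And>i. card {c. (Some i, c) \<in> S} \<le> Poly_Mapping.lookup m i"
  shows "\<exists>t. edge_multiple E t m \<and> card S \<le> 2 * t + 2 * card {c. (None, c) \<in> S}"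
  using assms
proof (induction arbitrary: m rule: matchable.induct)
  case empty
  then show ?case by (auto intro: edge_multiple.zero)
next
  case (insert S x y)
  obtain a c where x: "x = (a, c)" by (cases x)
  obtain b d where y: "y = (b, d)" by (cases y)
  have fin: "finite {c. (z, c) \<in> S}" for z
    by (rule finite_subset[of _ "snd ` S"])
      (use finite_matchable[OF insert.hyps(1)] in force)+
  have card_SS: "card (insert x (insert y S)) = card S + 2"
    using insert.hyps finite_matchable[OF insert.hyps(1)] by simp
  have c: "c \<notin> {c. (a, c) \<in> S}" and d: "d \<notin> {c. (b, c) \<in> S}"
    using insert.hyps x y by auto
  have adj: "cone_adj E a b" using insert.hyps(2) x y by (simp add: cone_blowup_def)
  show ?case
  proof (cases "a = None \<or> b = None")
    case True
    let ?N = "{c. (None, c) \<in> S}"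
    have "{c. (None, c) \<in> insert x (insert y S)}
        = (if a = None then insert c ?N else insert d ?N)"
      using True adj x y by (cases a; cases b) auto
    then have N: "card {c. (None, c) \<in> insert x (insert y S)} = Suc (card ?N)"
      using True adj c d fin by (cases a; cases b) auto
    have "card {c. (Some i, c) \<in> S} \<le> Poly_Mapping.lookup m i" for i
    proof -
      have "card {c. (Some i, c) \<in> S} \<le> card {c. (Some i, c) \<in> insert x (insert y S)}"
        using fin[of "Some i"]
        by (intro card_mono) (auto simp: x y intro: finite_subset[of _ "insert c (insert d {c. (Some i, c) \<in> S})"])
      then show ?thesis using insert.prems(2)[of i] by linarith
    qed
    from insert.IH[OF insert.prems(1) this] obtain t
      where "edge_multiple E t m" "card S \<le> 2 * t + 2 * card ?N" by blast
    then show ?thesis using N card_SS by (intro exI[of _ t]) auto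
  next
    case False
    then obtain u v where u: "a = Some u" and v: "b = Some v" by auto
    have uv: "(u, v) \<in> E" "u \<noteq> v" using adj u v \<open>irrefl E\<close> by (auto simp: irrefl_def)
    \<comment> \<open>The subtraction is truncated, but the matched copies of \<open>u\<close> and
      \<open>v\<close> force both exponents to be positive, so \<open>m\<close> is recovered from
      \<open>m'\<close> below.\<close>
    define m' where "m' = m - Poly_Mapping.single u 1 - Poly_Mapping.single v 1"
    have "{k. (Some i, k) \<in> insert x (insert y S)}
        = (if i = u then insert c else if i = v then insert d else id) {k. (Some i, k) \<in> S}" for i
      using x y u v uv(2) by auto
    then have card: "card {k. (Some i, k) \<in> insert x (insert y S)}
        = (if i = u \<or> i = v then 1 else 0) + card {k. (Some i, k) \<in> S}" for i
      using c d fin u v by auto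
    have m'_lookup: "Poly_Mapping.lookup m' i = Poly_Mapping.lookup m i - (if i = u \<or> i = v then 1 else 0)" for i
      using uv(2) by (auto simp: m'_def lookup_minus lookup_single when_def)
    have le: "(if i = u \<or> i = v then 1 else 0) + card {k. (Some i, k) \<in> S} \<le> Poly_Mapping.lookup m i" for i
      using insert.prems(2)[of i] unfolding card .
    have m: "m = m' + Poly_Mapping.single u 1 + Poly_Mapping.single v 1"
    proof (rule poly_mapping_eqI)
      fix i
      show "Poly_Mapping.lookup m i = Poly_Mapping.lookup (m' + Poly_Mapping.single u 1 + Poly_Mapping.single v 1) i"
        using le[of i] uv(2) by (auto simp: m'_lookup lookup_add lookup_single when_def)
    qed
    have "card {k. (Some i, k) \<in> S} \<le> Poly_Mapping.lookup m' i" for i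
      using le[of i] by (auto simp: m'_lookup)
    from insert.IH[OF insert.prems(1) this] obtain t
      where t: "edge_multiple E t m'" "card S \<le> 2 * t + 2 * card {c. (None, c) \<in> S}" by blast
    have "edge_multiple E (Suc t) m"
      unfolding m using t(1) uv(1) by (rule edge_multiple.Suc)
    moreover have "{c. (None, c) \<in> insert x (insert y S)} = {c. (None, c) \<in> S}"
      using x y u v by auto
    ultimately show ?thesis using t(2) card_SS by (intro exI[of _ "Suc t"]) auto
  qed
qed

lemma edge_multiple_mono:
  assumes "edge_multiple E t m" "t' \<le> t"
  shows "edge_multiple E t' m"
  using assms
proof (induction arbitrary: t' rule: edge_multiple.induct)
  case (Suc t m i j)
  then show ?case
    by (cases t') (auto intro: edge_multiple.intros simp del: One_nat_def)
qed (auto intro: edge_multiple.zero)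

text \<open>With \<open>d\<close> apex copies filling the deficiency of
  \<open>weighted_Hall_deficiency\<close>, the cone has a matching that misses at most one vertex.
  Dropping its at most \<open>d\<close> edges at the apex leaves at least
  \<open>min s (|m| div 2)\<close> edges, where \<open>|m|\<close> is the total weight.\<close>

lemma edge_multiple_if_covers:
  fixes m :: "'a \<Rightarrow>\<^sub>0 nat"
  assumes "finite V" "sym E" "irrefl E"
    and nonnbr: "\<And>v. v \<in> V \<Longrightarrow> bipartite E {u \<in> V. (v, u) \<notin> E}"
    and cover: "\<And>F. F \<subseteq> V \<Longrightarrow> independent E F \<Longrightarrow> s \<le> sum (Poly_Mapping.lookup m) (V - F)"
    and "t \<le> s" "2 * t \<le> sum (Poly_Mapping.lookup m) V"
  shows "edge_multiple E t m"
proof -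
  \<comment> \<open>Truncated: \<open>d = 0\<close> if the weight is below \<open>2 * s\<close>, and
    then half of the weight limits the matching.\<close>
  define d where "d = sum (Poly_Mapping.lookup m) V - 2 * s"
  define w where "w = case_option d (Poly_Mapping.lookup m)"
  define V' where "V' = insert None (Some ` V)"
  define X where "X = (SIGMA x : V'. {..<w x})"
  let ?E = "cone_blowup E"
  have finV': "finite V'" using assms(1) by (simp add: V'_def)
  have cardSig: "card (SIGMA x : U. {..<w x}) = sum w U" if "finite U" for U
    using that by (simp add: card_SigmaI)
  have sumSome: "sum w (Some ` U) = sum (Poly_Mapping.lookup m) U" for U
    by (simp add: sum.reindex w_def)
  have "\<exists>S \<subseteq> X. matchable ?E S \<and> card X \<le> card S + 1"
  proof (rule near_matchable)
    show "finite X" using finV' by (simp add: X_def)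
    show "sym ?E"
    proof (rule symI)
      fix x y :: "'a option \<times> nat" assume "(x, y) \<in> ?E"
      then show "(y, x) \<in> ?E"
        using \<open>sym E\<close> by (cases "fst x"; cases "fst y") (auto simp: cone_blowup_def dest: symD)
    qed
    have "\<not> cone_adj E x x" for x using \<open>irrefl E\<close> by (cases x) (auto simp: irrefl_def)
    then show "irrefl ?E" by (auto simp: irrefl_def cone_blowup_def)
  next
    fix J assume J: "J \<subseteq> X"
    define U where "U = fst ` J"
    have UV: "U \<subseteq> V'" using J by (auto simp: U_def X_def)
    define N where "N = {y \<in> V'. \<exists>x \<in> U. cone_adj E x y}"
    have "sum w U \<le> sum w N"
    proof (cases "None \<in> U")
      case False
      show ?thesis
      proof (cases "U = {}")
        case nonempty: False
        obtain T where T: "U = Some ` T" "T \<subseteq> V"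
        proof
          show "U = Some ` (Some -` U)" using False UV by (auto simp: V'_def)
          show "Some -` U \<subseteq> V" using UV by (auto simp: V'_def)
        qed
        \<comment> \<open>The apex is adjacent to all of the nonempty \<open>T\<close>, and its
          \<open>d\<close> copies make up the deficiency.\<close>
        have "sum w U \<le> d + sum (Poly_Mapping.lookup m) {v \<in> V. \<exists>u \<in> T. (u, v) \<in> E}"
          unfolding T(1) sumSome d_def
          using assms(1,2) T(2) by (intro weighted_Hall_deficiency nonnbr cover) auto
        also have "\<dots> = sum w (insert None (Some ` {v \<in> V. \<exists>u \<in> T. (u, v) \<in> E}))"
          using assms(1) by (simp add: sumSome) (simp add: w_def)
        also have "\<dots> \<le> sum w N"
          using finV' nonempty unfolding N_def T(1) V'_def by (intro sum_mono2) auto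
        finally show ?thesis .
      qed simp
    next
      case True
      \<comment> \<open>The apex reaches all of \<open>V\<close>, and any further vertex of
        \<open>U\<close> reaches the apex, so only \<open>U = {None}\<close> needs the bound on
        \<open>d\<close>.\<close>
      then have Some: "Some ` V \<subseteq> N" by (auto simp: N_def V'_def intro!: bexI[of _ None])
      show ?thesis
      proof (cases "U = {None}")
        case True
        have "sum w U = d" using True by (simp add: w_def)
        also have "\<dots> \<le> sum w (Some ` V)" by (simp add: sumSome d_def)
        also have "\<dots> \<le> sum w N" using Some finV' by (intro sum_mono2) (auto simp: N_def)
        finally show ?thesis .
      next
        case False
        then obtain u where "Some u \<in> U" using True
          by (metis insertI1 option.exhaust subsetI singletonD subset_antisym empty_iff subset_singletonD)
        then have "None \<in> N" by (auto simp: N_def V'_def intro!: bexI[of _ "Some u"])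
        then have "U \<subseteq> N" using Some UV unfolding V'_def by blast
        then show ?thesis using finV' by (intro sum_mono2) (auto simp: N_def)
      qed
    qed
    moreover have "card J \<le> card (SIGMA x : U. {..<w x})"
      using J UV finV' by (intro card_mono) (auto simp: U_def X_def intro: finite_subset rev_image_eqI)
    moreover have "{y \<in> X. \<exists>x \<in> J. (x, y) \<in> ?E} = (SIGMA x : N. {..<w x})"
      by (auto simp: X_def N_def U_def cone_blowup_def) force+
    moreover have "finite N" "finite U" using finV' UV by (auto simp: N_def intro: finite_subset)
    ultimately show "card J \<le> card {y \<in> X. \<exists>x \<in> J. (x, y) \<in> ?E}" by (simp add: cardSig)
  next
    fix B B' assume BX: "B \<subseteq> X" "B' \<subseteq> X" and nb: "\<not> bipartite ?E B" "\<not> bipartite ?E B'"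
    \<comment> \<open>Apex copies alone are independent, so each block has a non-apex vertex, to
      which an apex copy in the other block is joined.\<close>
    have apex: "independent ?E {x. fst x = None}"
      by (auto simp: independent_def cone_blowup_def)
    have notNone: "\<exists>x \<in> A. fst x \<noteq> None" if "\<not> bipartite ?E A" for A
      using that apex unfolding bipartite_def by blast
    show "\<exists>b \<in> B. \<exists>b' \<in> B'. (b, b') \<in> ?E"
    proof (cases "\<exists>x \<in> B \<union> B'. fst x = None")
      case True
      then show ?thesis
        using notNone[OF nb(1)] notNone[OF nb(2)] by (force simp: cone_blowup_def)
    next
      case False
      \<comment> \<open>If no edge joined the blocks, \<open>B'\<close> would consist of copies of
        non-neighbours of \<open>v\<close> and so be bipartite.\<close>
      obtain v c where v: "(Some v, c) \<in> B" using notNone[OF nb(1)] by force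
      then have "v \<in> V" using BX(1) by (auto simp: X_def V'_def)
      from nonnbr[OF this] obtain P Q where
        PQ: "independent E P" "independent E Q" "{u \<in> V. (v, u) \<notin> E} \<subseteq> P \<union> Q"
        unfolding bipartite_def by blast
      show ?thesis
      proof (rule ccontr)
        assume no: "\<not> ?thesis"
        have "B' \<subseteq> {x. fst x \<in> Some ` P} \<union> {x. fst x \<in> Some ` Q}"
        proof
          fix x assume x: "x \<in> B'"
          obtain u k where u: "x = (Some u, k)" using False x by (metis UnCI option.exhaust prod.collapse)
          have "u \<in> V" using BX(2) x u by (auto simp: X_def V'_def)
          moreover have "(v, u) \<notin> E" using no v x u by (force simp: cone_blowup_def)
          ultimately show "x \<in> {x. fst x \<in> Some ` P} \<union> {x. fst x \<in> Some ` Q}"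
            using PQ(3) u by auto
        qed
        moreover have "independent ?E {x. fst x \<in> Some ` U}" if "independent E U" for U
          using that by (auto simp: independent_def cone_blowup_def)
        ultimately show False using nb(2) PQ(1,2) unfolding bipartite_def by blast
      qed
    qed
  qed
  then obtain S where S: "S \<subseteq> X" "matchable ?E S" "card X \<le> card S + 1" by blast
  have fib: "card {c. (x, c) \<in> S} \<le> w x" for x
  proof -
    have "{c. (x, c) \<in> S} \<subseteq> {..<w x}" using S(1) by (auto simp: X_def)
    then show ?thesis by (metis card_lessThan card_mono finite_lessThan)
  qed
  obtain t' where t': "edge_multiple E t' m" "card S \<le> 2 * t' + 2 * card {c. (None, c) \<in> S}"
    using edge_multiple_of_matchable[OF S(2) assms(3), of m] fib[of "Some _"]
    by (auto simp: w_def)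
  have "card X = d + sum (Poly_Mapping.lookup m) V"
    using assms(1) finV' by (simp add: X_def cardSig V'_def sumSome) (simp add: w_def)
  moreover have "card {c. (None, c) \<in> S} \<le> d" using fib[of None] by (simp add: w_def)
  \<comment> \<open>Parity makes \<open>card S\<close> the largest even number not above
    \<open>card X\<close>, which absorbs the unmatched vertex.\<close>
  moreover obtain k where "card S = 2 * k" using even_card_matchable[OF S(2)] by blast
  ultimately have "t \<le> t'" using t'(2) S(3) assms(6,7) unfolding d_def by linarith
  then show ?thesis using t'(1) edge_multiple_mono by blast
qed

section \<open>Divisibility of monomials by products of edges\<close>

lemma edge_multiple_add:
  assumes "edge_multiple E s a" "edge_multiple E t b"
  shows "edge_multiple E (s + t) (a + b)"
  using assms(2,1)
proof (induction rule: edge_multiple.induct)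
  case (zero m)
  have "edge_multiple E s (a + m)"
    using zero
  proof (induction rule: edge_multiple.induct)
    case (Suc t n i j)
    have "edge_multiple E (Suc t) ((n + m) + Poly_Mapping.single i 1 + Poly_Mapping.single j 1)"
      using Suc by (intro edge_multiple.Suc)
    then show ?case by (simp only: ac_simps)
  qed (rule edge_multiple.zero)
  then show ?case by simp
next
  case (Suc t m i j)
  have "edge_multiple E (Suc (s + t)) ((a + m) + Poly_Mapping.single i 1 + Poly_Mapping.single j 1)"
    using Suc by (intro edge_multiple.Suc)
  then show ?case by (simp only: ac_simps add_Suc_right)
qed

lemma edge_multiple_le:
  assumes "edge_multiple E t a" "\<And>i. Poly_Mapping.lookup a i \<le> Poly_Mapping.lookup b i"
  shows "edge_multiple E t b"
proof -
  have "b = a + (b - a)"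
    using assms(2) by (intro poly_mapping_eqI) (simp add: lookup_add lookup_minus)
  then show ?thesis using edge_multiple_add[OF assms(1) edge_multiple.zero, of "b - a"] by simp
qed

text \<open>Without loops the ends of an edge are distinct variables, so two positive exponents
  already give divisibility.\<close>

lemma edge_multiple_1_iff:
  assumes "irrefl E"
  shows "edge_multiple E 1 m
    \<longleftrightarrow> (\<exists>(i, j) \<in> E. Poly_Mapping.lookup m i \<noteq> 0 \<and> Poly_Mapping.lookup m j \<noteq> 0)"
proof
  assume "edge_multiple E 1 m"
  then obtain n i j where "m = n + Poly_Mapping.single i 1 + Poly_Mapping.single j 1" "(i, j) \<in> E"
    by cases auto
  then show "\<exists>(i, j) \<in> E. Poly_Mapping.lookup m i \<noteq> 0 \<and> Poly_Mapping.lookup m j \<noteq> 0"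
    by (intro bexI[of _ "(i, j)"]) (auto simp: lookup_add)
next
  assume "\<exists>(i, j) \<in> E. Poly_Mapping.lookup m i \<noteq> 0 \<and> Poly_Mapping.lookup m j \<noteq> 0"
  then obtain i j where ij: "(i, j) \<in> E" "Poly_Mapping.lookup m i \<noteq> 0" "Poly_Mapping.lookup m j \<noteq> 0"
    by blast
  then have "i \<noteq> j" using assms by (auto simp: irrefl_def)
  have "edge_multiple E (Suc 0) (0 + Poly_Mapping.single i 1 + Poly_Mapping.single j 1)"
    using ij(1) by (intro edge_multiple.intros)
  then show "edge_multiple E 1 m"
    unfolding One_nat_def
    by (rule edge_multiple_le)
      (use ij \<open>i \<noteq> j\<close> in \<open>auto simp: lookup_add lookup_single when_def\<close>)
qed

text \<open>\<open>C\<close> is a vertex cover, so each of the \<open>t\<close> edge factors adds at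
  least one to the \<open>C\<close>-degree.\<close>

lemma edge_multiple_cover:
  assumes "edge_multiple E t m" "finite C" "\<And>i j. (i, j) \<in> E \<Longrightarrow> i \<in> C \<or> j \<in> C"
  shows "t \<le> sum (Poly_Mapping.lookup m) C"
  using assms(1)
proof (induction rule: edge_multiple.induct)
  case (Suc t m i j)
  have single: "sum (Poly_Mapping.lookup (Poly_Mapping.single k 1)) C = (if k \<in> C then 1 else (0::nat))" for k
    using assms(2) by (simp add: lookup_single when_def)
  have "1 \<le> sum (Poly_Mapping.lookup (Poly_Mapping.single i 1)) C
      + sum (Poly_Mapping.lookup (Poly_Mapping.single j (1::nat))) C"
    unfolding single using assms(3)[OF Suc.hyps(2)] by auto
  then show ?case using Suc.IH by (simp add: lookup_add sum.distrib)
qed simp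

lemma edge_multiple_sum:
  assumes "finite C" "\<And>i. i \<in> C \<Longrightarrow> edge_multiple E (t i) (m i)"
  shows "edge_multiple E (sum t C) (sum m C)"
  using assms by (induction rule: finite_induct) (auto intro: edge_multiple.zero edge_multiple_add)

lemma edge_multiple_single:
  assumes "(i, j) \<in> E"
  shows "edge_multiple E k (Poly_Mapping.single i k + Poly_Mapping.single j k)"
proof (induction k)
  case (Suc k)
  have "edge_multiple E (Suc k) (Poly_Mapping.single i k + Poly_Mapping.single j k
      + Poly_Mapping.single i 1 + Poly_Mapping.single j 1)"
    using Suc assms by (rule edge_multiple.Suc)
  moreover have "Poly_Mapping.single i k + Poly_Mapping.single j k
      + Poly_Mapping.single i 1 + Poly_Mapping.single j 1
      = Poly_Mapping.single i (Suc k) + Poly_Mapping.single j (Suc k)"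
    by (rule poly_mapping_eqI) (auto simp: lookup_add lookup_single when_def)
  ultimately show ?case by simp
qed (rule edge_multiple.zero)

section \<open>Monomial ideals\<close>

lemma mpoly_ring_simps [simp]:
  "monoid.mult (mpoly_ring V) = (*)" "one (mpoly_ring V) = 1"
  "zero (mpoly_ring V) = 0" "add (mpoly_ring V) = (+)"
  by (simp_all add: mpoly_ring_def)

lemma mem_mpoly_ring:
  "f \<in> carrier (mpoly_ring V) \<longleftrightarrow> (\<forall>m \<in> Poly_Mapping.keys f. Poly_Mapping.keys m \<subseteq> V)"
  by (simp add: mpoly_ring_def)

lemma single_in_mpoly_ring:
  "Poly_Mapping.keys m \<subseteq> V \<Longrightarrow> Poly_Mapping.single m c \<in> carrier (mpoly_ring V)"
  by (simp add: mem_mpoly_ring)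

lemma keys_add_nat:
  fixes a b :: "'a \<Rightarrow>\<^sub>0 nat"
  shows "Poly_Mapping.keys (a + b) = Poly_Mapping.keys a \<union> Poly_Mapping.keys b"
  by (auto simp: in_keys_iff lookup_add)

lemma poly_mapping_eq_sum_singles:
  "f = (\<Sum>m \<in> Poly_Mapping.keys f. Poly_Mapping.single m (Poly_Mapping.lookup f m))"
  by (rule poly_mapping_eqI) (simp add: lookup_sum lookup_single when_def in_keys_iff)

text \<open>Shifting exponents by \<open>a\<close> is injective, so no terms cancel.\<close>

lemma keys_mult_single:
  fixes f :: "'k::field mpoly"
  shows "Poly_Mapping.keys (f * Poly_Mapping.single a 1) = (\<lambda>m. m + a) ` Poly_Mapping.keys f"
proof
  show "Poly_Mapping.keys (f * Poly_Mapping.single a 1) \<subseteq> (\<lambda>m. m + a) ` Poly_Mapping.keys f"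
    using Poly_Mapping.keys_mult[of f "Poly_Mapping.single a 1"] by auto
  have "f * Poly_Mapping.single a 1
      = (\<Sum>m \<in> Poly_Mapping.keys f. Poly_Mapping.single m (Poly_Mapping.lookup f m)) * Poly_Mapping.single a 1"
    using poly_mapping_eq_sum_singles[of f] by simp
  also have "\<dots> = (\<Sum>m \<in> Poly_Mapping.keys f. Poly_Mapping.single (m + a) (Poly_Mapping.lookup f m))"
    by (simp add: sum_distrib_right mult_single)
  finally have eq: "f * Poly_Mapping.single a 1 = \<dots>" .
  have "Poly_Mapping.lookup (f * Poly_Mapping.single a 1) (m + a) = Poly_Mapping.lookup f m" for m
    unfolding eq by (simp add: lookup_sum lookup_single when_def in_keys_iff)
  then show "(\<lambda>m. m + a) ` Poly_Mapping.keys f \<subseteq> Poly_Mapping.keys (f * Poly_Mapping.single a 1)"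
    by (auto simp: in_keys_iff)
qed

text \<open>The lowest homogeneous parts of \<open>f\<close> and \<open>g\<close> have a non-zero product.\<close>

lemma mult_low_degree:
  fixes f g :: "'k::field mpoly" and \<phi> :: "(nat \<Rightarrow>\<^sub>0 nat) \<Rightarrow> nat"
  assumes add: "\<And>a b. \<phi> (a + b) = \<phi> a + \<phi> b"
    and m: "m \<in> Poly_Mapping.keys f" and n: "n \<in> Poly_Mapping.keys g"
  shows "\<exists>k \<in> Poly_Mapping.keys (f * g). \<phi> k \<le> \<phi> m + \<phi> n"
proof -
  define low :: "'k mpoly \<Rightarrow> nat \<Rightarrow> 'k mpoly" where
    "low h d = (\<Sum>m \<in> {m \<in> Poly_Mapping.keys h. \<phi> m = d}. Poly_Mapping.single m (Poly_Mapping.lookup h m))" for h d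
  have lookup_low: "Poly_Mapping.lookup (low h d) m = (if \<phi> m = d then Poly_Mapping.lookup h m else 0)" for h d m
    by (simp add: low_def lookup_sum lookup_single when_def in_keys_iff)
  have split: "\<exists>d \<le> \<phi> m. low h d \<noteq> 0 \<and> (\<forall>k \<in> Poly_Mapping.keys (low h d). \<phi> k = d)
      \<and> (\<forall>k \<in> Poly_Mapping.keys (h - low h d). d < \<phi> k)"
    if m: "m \<in> Poly_Mapping.keys h" for h m
  proof -
    obtain m0 where m0: "m0 \<in> Poly_Mapping.keys h" "\<And>k. k \<in> Poly_Mapping.keys h \<Longrightarrow> \<phi> m0 \<le> \<phi> k"
      using ex_has_least_nat[of "\<lambda>k. k \<in> Poly_Mapping.keys h" m \<phi>] m by blast
    have "Poly_Mapping.lookup (low h (\<phi> m0)) m0 \<noteq> 0"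
      using m0(1) by (simp add: lookup_low in_keys_iff)
    then have "low h (\<phi> m0) \<noteq> 0" by auto
    moreover have "\<phi> m0 < \<phi> k" if "k \<in> Poly_Mapping.keys (h - low h (\<phi> m0))" for k
    proof -
      have "k \<in> Poly_Mapping.keys h \<and> \<phi> k \<noteq> \<phi> m0"
        using that by (auto simp: in_keys_iff lookup_minus lookup_low split: if_splits)
      then show ?thesis using m0(2)[of k] by simp
    qed
    ultimately show ?thesis
      using m0(2)[OF m] by (intro exI[of _ "\<phi> m0"]) (auto simp: in_keys_iff lookup_low split: if_splits)
  qed
  obtain a where a: "a \<le> \<phi> m" "low f a \<noteq> 0" "\<And>k. k \<in> Poly_Mapping.keys (low f a) \<Longrightarrow> \<phi> k = a"
    "\<And>k. k \<in> Poly_Mapping.keys (f - low f a) \<Longrightarrow> a < \<phi> k" using split[OF m] by blast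
  obtain b where b: "b \<le> \<phi> n" "low g b \<noteq> 0" "\<And>k. k \<in> Poly_Mapping.keys (low g b) \<Longrightarrow> \<phi> k = b"
    "\<And>k. k \<in> Poly_Mapping.keys (g - low g b) \<Longrightarrow> b < \<phi> k" using split[OF n] by blast
  have b': "b \<le> \<phi> k" if "k \<in> Poly_Mapping.keys g" for k
  proof (cases "k \<in> Poly_Mapping.keys (low g b)")
    case False
    then have "k \<in> Poly_Mapping.keys (g - low g b)"
      using that by (simp add: in_keys_iff lookup_minus)
    then show ?thesis using b(4)[of k] by simp
  qed (use b(3) in simp)
  \<comment> \<open>Polynomials form a domain. A monomial \<open>k\<close> of this product has
    weight \<open>a + b\<close>, whereas the other two summands of \<open>f * g\<close> below have
    only monomials of larger weight.\<close>
  have "low f a * low g b \<noteq> 0" using a(2) b(2) by simp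
  then obtain k where k: "k \<in> Poly_Mapping.keys (low f a * low g b)"
    by (metis keys_eq_empty subset_empty subsetI)
  then have \<phi>k: "\<phi> k = a + b"
    using Poly_Mapping.keys_mult[of "low f a" "low g b"] a(3) b(3) add by fastforce
  have "k \<notin> Poly_Mapping.keys (low f a * (g - low g b))"
    using Poly_Mapping.keys_mult[of "low f a" "g - low g b"] a(3) b(4) add \<phi>k by fastforce
  moreover have "k \<notin> Poly_Mapping.keys ((f - low f a) * g)"
    using Poly_Mapping.keys_mult[of "f - low f a" g] a(4) b' add \<phi>k by fastforce
  moreover have "f * g = low f a * low g b + low f a * (g - low g b) + (f - low f a) * g"
    by (simp add: algebra_simps)
  ultimately have "Poly_Mapping.lookup (f * g) k = Poly_Mapping.lookup (low f a * low g b) k"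
    by (simp only: lookup_add) (simp add: in_keys_iff)
  then have "k \<in> Poly_Mapping.keys (f * g)" using k by (simp add: in_keys_iff)
  then show ?thesis using \<phi>k a(1) b(1) by (intro bexI[of _ k]) auto
qed

definition monomial_ideal :: "nat set \<Rightarrow> (nat \<Rightarrow>\<^sub>0 nat) set \<Rightarrow> 'k::field mpoly set" where
  "monomial_ideal V A = {f \<in> carrier (mpoly_ring V). Poly_Mapping.keys f \<subseteq> A}"

lemma ideal_monomial_ideal:
  assumes "\<And>a b. a \<in> A \<Longrightarrow> a + b \<in> A"
  shows "ideal (monomial_ideal V A :: 'k::field mpoly set) (mpoly_ring V)"
proof -
  interpret cring "mpoly_ring V :: 'k mpoly ring" by (rule cring_mpoly_ring)
  have mult: "x * a \<in> monomial_ideal V A"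
    if "a \<in> monomial_ideal V A" "x \<in> carrier (mpoly_ring V)" for a x :: "'k mpoly"
  proof -
    have "x * a \<in> carrier (mpoly_ring V)"
      using that m_closed[of x a] by (simp add: monomial_ideal_def)
    moreover have "Poly_Mapping.keys (x * a) \<subseteq> A"
    proof
      fix k assume "k \<in> Poly_Mapping.keys (x * a)"
      then obtain m n where "k = m + n" "n \<in> Poly_Mapping.keys a"
        using Poly_Mapping.keys_mult[of x a] by blast
      then show "k \<in> A"
        using assms[of n m] that(1) by (auto simp: monomial_ideal_def add.commute)
    qed
    ultimately show ?thesis by (simp add: monomial_ideal_def)
  qed
  show ?thesis
  proof (rule idealI)
    show "ring (mpoly_ring V :: 'k mpoly ring)" by (rule ring_axioms)
    show "subgroup (monomial_ideal V A) (add_monoid (mpoly_ring V :: 'k mpoly ring))"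
    proof (rule add.subgroupI)
      have "(0 :: 'k mpoly) \<in> monomial_ideal V A" by (simp add: monomial_ideal_def mem_mpoly_ring)
      then show "monomial_ideal V A \<noteq> ({} :: 'k mpoly set)" by blast
    next
      fix f :: "'k mpoly" assume f: "f \<in> monomial_ideal V A"
      have "- f \<in> monomial_ideal V A" using f by (simp add: monomial_ideal_def mem_mpoly_ring)
      moreover have "\<ominus>\<^bsub>mpoly_ring V\<^esub> f = - f"
        using f by (intro minus_equality) (auto simp: monomial_ideal_def mem_mpoly_ring)
      ultimately show "\<ominus>\<^bsub>mpoly_ring V\<^esub> f \<in> monomial_ideal V A" by simp
    next
      fix f g :: "'k mpoly" assume "f \<in> monomial_ideal V A" "g \<in> monomial_ideal V A"
      then show "f \<oplus>\<^bsub>mpoly_ring V\<^esub> g \<in> monomial_ideal V A"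
        using Poly_Mapping.keys_add[of f g] by (simp add: monomial_ideal_def mem_mpoly_ring) blast
    qed (auto simp: monomial_ideal_def)
  qed (use mult in \<open>auto simp: mult.commute\<close>)
qed

lemma ideal_mem_if_monomials:
  fixes f :: "'k::field mpoly"
  assumes "ideal J (mpoly_ring V)"
    and "\<And>m. m \<in> Poly_Mapping.keys f \<Longrightarrow> Poly_Mapping.single m (Poly_Mapping.lookup f m) \<in> J"
  shows "f \<in> J"
proof -
  interpret ideal J "mpoly_ring V :: 'k mpoly ring" by (rule assms(1))
  have "sum g S \<in> J" if "finite S" "\<And>m. m \<in> S \<Longrightarrow> g m \<in> J" for S and g :: "_ \<Rightarrow> 'k mpoly"
    using that
  proof (induction rule: finite_induct)
    case empty
    then show ?case using additive_subgroup.zero_closed[OF is_additive_subgroup] by simp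
  next
    case (insert x F)
    then show ?case using additive_subgroup.a_closed[OF is_additive_subgroup, of "g x" "sum g F"] by simp
  qed
  then show ?thesis using assms(2) poly_mapping_eq_sum_singles[of f] by (metis finite_keys)
qed

section \<open>Associated primes and contractions of extended ideals\<close>

text \<open>Every element of the quotient is the coset of some \<open>h\<close>, and a coset is zero
  iff its representative lies in \<open>I\<close>. Associated primes thus become prime colon ideals
  \<open>(I : h)\<close>.\<close>

lemma Ass_iff:
  assumes "ideal I R" "cring R"
  shows "p \<in> Ass R I \<longleftrightarrow> primeideal p R \<and> (\<exists>h \<in> carrier R. p = {g \<in> carrier R. g \<otimes>\<^bsub>R\<^esub> h \<in> I})"
proof -
  interpret ideal I R by fact
  interpret cring R by fact
  have coset: "I +>\<^bsub>R\<^esub> a = I \<longleftrightarrow> a \<in> I" if "a \<in> carrier R" for a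
    using that a_rcos_const a_rcos_self by blast
  have "(I +>\<^bsub>R\<^esub> g) \<otimes>\<^bsub>R Quot I\<^esub> (I +>\<^bsub>R\<^esub> h) = \<zero>\<^bsub>R Quot I\<^esub> \<longleftrightarrow> g \<otimes>\<^bsub>R\<^esub> h \<in> I"
    if "g \<in> carrier R" "h \<in> carrier R" for g h
  proof -
    have "(I +>\<^bsub>R\<^esub> g) \<otimes>\<^bsub>R Quot I\<^esub> (I +>\<^bsub>R\<^esub> h) = I +>\<^bsub>R\<^esub> (g \<otimes>\<^bsub>R\<^esub> h)"
      using rcoset_mult_add[OF that] by (simp add: FactRing_def)
    moreover have "\<zero>\<^bsub>R Quot I\<^esub> = I" by (simp add: FactRing_def)
    ultimately show ?thesis using coset[of "g \<otimes>\<^bsub>R\<^esub> h"] that by simp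
  qed
  then have ann: "{g \<in> carrier R. (I +>\<^bsub>R\<^esub> g) \<otimes>\<^bsub>R Quot I\<^esub> (I +>\<^bsub>R\<^esub> h) = \<zero>\<^bsub>R Quot I\<^esub>}
      = {g \<in> carrier R. g \<otimes>\<^bsub>R\<^esub> h \<in> I}" if "h \<in> carrier R" for h
    using that by blast
  have "carrier (R Quot I) = (\<lambda>h. I +>\<^bsub>R\<^esub> h) ` carrier R"
    unfolding FactRing_def by (auto simp: A_RCOSETS_def')
  then show ?thesis using ann by (simp add: Ass_def)
qed

text \<open>By common denominators, the fractions with numerator in \<open>J\<close> form an ideal
  of the localization. It contains the image of \<open>J\<close>, hence also the ideal generated by
  that image.\<close>

lemma extension_subset:
  fixes A :: "'b::idom set"
  assumes "primeideal p (ring_on A)" "ideal J (ring_on A)"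
  shows "extension (ring_on A) p J \<subseteq> {Fraction_Field.Fract a u |a u. a \<in> J \<and> u \<in> A - p}"
proof -
  define R where "R = ring_on A"
  interpret p: primeideal p R unfolding R_def by fact
  interpret J: ideal J R unfolding R_def by fact
  have carrier_loc: "carrier (localization R p) = {Fraction_Field.Fract a u |a u. a \<in> A \<and> u \<in> A - p}"
    by (simp add: localization_def R_def)
  have nz: "u \<noteq> 0" if "u \<in> A - p" for u
    using that additive_subgroup.zero_closed[OF p.is_additive_subgroup] by (auto simp: R_def)
  have one: "1 \<in> A - p"
    using p.one_imp_carrier p.I_notcarr p.one_closed by (auto simp: R_def)
  have mp: "u * v \<in> A - p" if "u \<in> A - p" "v \<in> A - p" for u v
    using that p.I_prime[of u v] p.m_closed[of u v] by (auto simp: R_def)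
  have JA: "a \<in> A" if "a \<in> J" for a
    using J.Icarr[OF that] by (simp add: R_def)
  have Jl: "x * a \<in> J" if "a \<in> J" "x \<in> A" for a x
    using J.I_l_closed[of a x] that by (simp add: R_def)
  have Ja: "a + b \<in> J" if "a \<in> J" "b \<in> J" for a b
    using additive_subgroup.a_closed[OF J.is_additive_subgroup, of a b] that by (simp add: R_def)
  let ?L = "localization R p"
  let ?S = "{Fraction_Field.Fract a u |a u. a \<in> J \<and> u \<in> A - p}"
  interpret L: cring ?L
    by (rule cring_localization[of _ A]) (simp_all add: R_def assms(1))
  have opL: "monoid.mult ?L = (*)" "add ?L = (+)" "zero ?L = 0"
    by (simp_all add: localization_def)
  have SL: "x * y \<in> ?S" if xy: "x \<in> carrier ?L" "y \<in> ?S" for x y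
  proof -
    obtain a u b v where "x = Fraction_Field.Fract a u" "a \<in> A" "u \<in> A - p"
      "y = Fraction_Field.Fract b v" "b \<in> J" "v \<in> A - p"
      using xy carrier_loc by blast
    then show ?thesis using Jl[of b a] mp[of u v] by auto
  qed
  have Scarr: "?S \<subseteq> carrier ?L" using JA carrier_loc by blast
  have "ideal ?S ?L"
  proof (rule idealI)
    show "ring ?L" by (rule L.ring_axioms)
    show "subgroup ?S (add_monoid ?L)"
    proof (rule L.add.subgroupI)
      show "?S \<subseteq> carrier ?L" by (rule Scarr)
      show "?S \<noteq> {}"
        using additive_subgroup.zero_closed[OF J.is_additive_subgroup] one by blast
    next
      fix x assume x: "x \<in> ?S"
      \<comment> \<open>Negation is multiplication by minus one, so closure under scalars
        suffices.\<close>
      then have "(\<ominus>\<^bsub>?L\<^esub> \<one>\<^bsub>?L\<^esub>) * x \<in> ?S"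
        by (intro SL L.a_inv_closed L.one_closed)
      moreover have "(\<ominus>\<^bsub>?L\<^esub> \<one>\<^bsub>?L\<^esub>) \<otimes>\<^bsub>?L\<^esub> x = \<ominus>\<^bsub>?L\<^esub> x"
        using x Scarr by (simp add: L.l_minus subset_iff)
      ultimately show "\<ominus>\<^bsub>?L\<^esub> x \<in> ?S" by (simp add: opL)
    next
      fix x y assume "x \<in> ?S" "y \<in> ?S"
      then obtain a u b v where x: "x = Fraction_Field.Fract a u" "a \<in> J" "u \<in> A - p"
        and y: "y = Fraction_Field.Fract b v" "b \<in> J" "v \<in> A - p" by blast
      have "x + y = Fraction_Field.Fract (a * v + b * u) (u * v)"
        unfolding x(1) y(1) using nz x(3) y(3) by (intro add_fract) simp_all
      moreover have "a * v + b * u \<in> J"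
        using Ja Jl[of a v] Jl[of b u] x y by (simp add: mult.commute)
      ultimately show "x \<oplus>\<^bsub>?L\<^esub> y \<in> ?S" using mp[OF x(3) y(3)] by (auto simp: opL)
    qed
  next
    fix a x assume ax: "a \<in> ?S" "x \<in> carrier ?L"
    show "x \<otimes>\<^bsub>?L\<^esub> a \<in> ?S" using SL[OF ax(2,1)] by (simp only: opL)
    then show "a \<otimes>\<^bsub>?L\<^esub> x \<in> ?S" by (simp only: opL mult.commute[of a x])
  qed
  moreover have "(\<lambda>f. Fraction_Field.Fract f 1) ` J \<subseteq> ?S" using one by blast
  ultimately show ?thesis
    unfolding extension_def R_def[symmetric] by (rule L.genideal_minimal)
qed

text \<open>Cross-multiplication in the domain clears the denominator \<open>u\<close>; conversely
  \<open>f / 1\<close> is \<open>1 / u\<close> times the image of \<open>u * f\<close>.\<close>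

lemma contraction_extension_iff:
  fixes A :: "'b::idom set"
  assumes p: "primeideal p (ring_on A)" and J: "ideal J (ring_on A)"
  shows "f \<in> contraction (ring_on A) (extension (ring_on A) p J)
    \<longleftrightarrow> f \<in> A \<and> (\<exists>u \<in> A - p. u * f \<in> J)"
proof -
  interpret p: primeideal p "ring_on A" by fact
  interpret J: ideal J "ring_on A" by fact
  have nz: "u \<noteq> 0" if "u \<in> A - p" for u
    using that additive_subgroup.zero_closed[OF p.is_additive_subgroup] by auto
  have one: "1 \<in> A - p"
    using p.one_imp_carrier p.I_notcarr p.one_closed by auto
  let ?L = "localization (ring_on A) p"
  interpret L: cring ?L by (rule cring_localization[OF refl p])
  have carrier_loc: "carrier ?L = {Fraction_Field.Fract a u |a u. a \<in> A \<and> u \<in> A - p}"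
    by (simp add: localization_def)
  have JL: "(\<lambda>f. Fraction_Field.Fract f 1) ` J \<subseteq> carrier ?L"
    using J.Icarr one carrier_loc by force
  show ?thesis
  proof
    assume "f \<in> contraction (ring_on A) (extension (ring_on A) p J)"
    then have f: "f \<in> A" "Fraction_Field.Fract f 1 \<in> extension (ring_on A) p J"
      by (auto simp: contraction_def)
    then obtain a u where "Fraction_Field.Fract f 1 = Fraction_Field.Fract a u" "a \<in> J" "u \<in> A - p"
      using extension_subset[OF assms] by blast
    moreover from this have "u * f = a" using nz[of u] by (simp add: eq_fract mult.commute)
    ultimately show "f \<in> A \<and> (\<exists>u \<in> A - p. u * f \<in> J)" using f(1) by blast
  next
    assume "f \<in> A \<and> (\<exists>u \<in> A - p. u * f \<in> J)"
    then obtain u where u: "f \<in> A" "u \<in> A - p" "u * f \<in> J" by blast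
    interpret E: ideal "extension (ring_on A) p J" ?L
      unfolding extension_def by (rule L.genideal_ideal[OF JL])
    have "Fraction_Field.Fract (u * f) 1 \<in> extension (ring_on A) p J"
      using L.genideal_self[OF JL] u(3) unfolding extension_def by blast
    moreover have "Fraction_Field.Fract 1 u \<in> carrier ?L"
      using one u(2) carrier_loc by blast
    ultimately have "Fraction_Field.Fract 1 u \<otimes>\<^bsub>?L\<^esub> Fraction_Field.Fract (u * f) 1
        \<in> extension (ring_on A) p J"
      by (rule E.I_l_closed)
    moreover have "monoid.mult ?L = (*)" by (simp add: localization_def)
    ultimately have "Fraction_Field.Fract 1 u * Fraction_Field.Fract (u * f) 1 \<in> extension (ring_on A) p J"
      by simp
    moreover have "Fraction_Field.Fract 1 u * Fraction_Field.Fract (u * f) 1 = Fraction_Field.Fract f 1"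
      using nz[OF u(2)] by (simp add: eq_fract)
    ultimately show "f \<in> contraction (ring_on A) (extension (ring_on A) p J)"
      using u(1) by (simp add: contraction_def)
  qed
qed

text \<open>Primality splits off one variable at a time, by induction on the degree; the constant
  monomial cannot lie in a proper ideal.\<close>

lemma primeideal_monomial:
  fixes p :: "'k::field mpoly set"
  assumes p: "primeideal p (mpoly_ring V)" and "Poly_Mapping.keys n \<subseteq> V"
    and "Poly_Mapping.single n 1 \<in> p"
  shows "\<exists>j \<in> Poly_Mapping.keys n. Var j \<in> p"
  using assms(2,3)
proof (induction "sum (Poly_Mapping.lookup n) (Poly_Mapping.keys n)" arbitrary: n rule: less_induct)
  case less
  interpret primeideal p "mpoly_ring V :: 'k mpoly ring" by (rule p)
  show ?case
  proof (cases "n = 0")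
    case True
    then have "\<one>\<^bsub>mpoly_ring V\<^esub> \<in> p" using less.prems(2) by simp
    then show ?thesis using one_imp_carrier I_notcarr by simp
  next
    case False
    then obtain j where j: "j \<in> Poly_Mapping.keys n" by fastforce
    define n' where "n' = n - Poly_Mapping.single j 1"
    have n: "n = n' + Poly_Mapping.single j 1"
      using j by (intro poly_mapping_eqI) (auto simp: n'_def lookup_add lookup_minus lookup_single when_def in_keys_iff)
    have keys: "Poly_Mapping.keys n = insert j (Poly_Mapping.keys n')"
      by (subst n) (simp add: keys_add_nat)
    have "Poly_Mapping.single n 1 = Poly_Mapping.single n' 1 * (Var j :: 'k mpoly)"
      by (subst n) (simp add: Var_def mult_single)
    then have "Poly_Mapping.single n' 1 \<otimes>\<^bsub>mpoly_ring V\<^esub> (Var j :: 'k mpoly) \<in> p"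
      using less.prems(2) by simp
    then have "Poly_Mapping.single n' (1::'k) \<in> p \<or> Var j \<in> p"
      using less.prems(1) keys by (intro I_prime single_in_mpoly_ring Var_in_mpoly_ring) auto
    then show ?thesis
    proof
      assume n'p: "Poly_Mapping.single n' (1::'k) \<in> p"
      have "sum (Poly_Mapping.lookup n') (Poly_Mapping.keys n') \<le> sum (Poly_Mapping.lookup n') (Poly_Mapping.keys n)"
        using keys by (intro sum_mono2) auto
      also have "\<dots> < sum (Poly_Mapping.lookup n) (Poly_Mapping.keys n)"
        using j by (intro sum_strict_mono_ex1) (auto simp: n'_def lookup_minus in_keys_iff intro!: bexI[of _ j])
      finally show ?thesis
        using less.hyps[of n'] n'p keys less.prems(1) by auto
    qed (use j in blast)
  qed
qed

section \<open>Powers and symbolic powers of edge ideals\<close>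

lemma pair_graph_parcs:
  assumes "pair_graph G"
  shows "finite (pverts G)" "sym (parcs G)" "irrefl (parcs G)" "parcs G \<subseteq> pverts G \<times> pverts G"
proof -
  interpret pair_graph G by fact
  show "finite (pverts G)" by (rule pair_finite_verts)
  show "sym (parcs G)" using pair_sym_arcs by (simp add: symmetric_def)
  show "irrefl (parcs G)" using pair_no_loops by (fastforce simp: irrefl_def)
  show "parcs G \<subseteq> pverts G \<times> pverts G"
    using arc_fst_in_verts arc_snd_in_verts by fastforce
qed

text \<open>The monomial description of the \<open>t\<close>-th power of the edge ideal;
  \<open>edge_ideal_power_eq\<close> identifies the two.\<close>

definition edge_monomial_ideal :: "nat pair_pre_digraph \<Rightarrow> nat \<Rightarrow> 'k::field mpoly set" where
  "edge_monomial_ideal G t = monomial_ideal (pverts G) {m. edge_multiple (parcs G) t m}"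

lemma ideal_edge_monomial_ideal:
  "ideal (edge_monomial_ideal G t :: 'k::field mpoly set) (mpoly_ring (pverts G))"
  unfolding edge_monomial_ideal_def
proof (rule ideal_monomial_ideal)
  fix a b assume "a \<in> {m. edge_multiple (parcs G) t m}"
  then show "a + b \<in> {m. edge_multiple (parcs G) t m}"
    using edge_multiple_add[OF _ edge_multiple.zero[of _ b]] by fastforce
qed

lemma mem_edge_monomial_ideal:
  "f \<in> edge_monomial_ideal G t \<longleftrightarrow> f \<in> carrier (mpoly_ring (pverts G))
    \<and> (\<forall>m \<in> Poly_Mapping.keys f. edge_multiple (parcs G) t m)"
  by (auto simp: edge_monomial_ideal_def monomial_ideal_def)

lemma Var_mult_Var: "Var i * Var j = Poly_Mapping.single (Poly_Mapping.single i 1 + Poly_Mapping.single j 1) 1"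
  by (simp add: Var_def mult_single)

lemma edge_multiple_1_edge:
  "(i, j) \<in> E \<Longrightarrow> edge_multiple E 1 (Poly_Mapping.single i 1 + Poly_Mapping.single j 1)"
  using edge_multiple_single[of i j E 1] by simp

lemma single_edge_multiple_split:
  assumes "edge_multiple E (Suc t) m" "E \<subseteq> V \<times> V" "Poly_Mapping.keys m \<subseteq> V"
  obtains n i j where "edge_multiple E t n" "(i, j) \<in> E" "Poly_Mapping.keys n \<subseteq> V"
    "\<And>c :: 'k::field. Poly_Mapping.single m c = Poly_Mapping.single n c * (Var i * Var j)"
proof -
  from assms(1) obtain n i j where n: "m = n + Poly_Mapping.single i 1 + Poly_Mapping.single j 1"
    "edge_multiple E t n" "(i, j) \<in> E" by cases auto
  show ?thesis
  proof (rule that[OF n(2,3)])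
    show "Poly_Mapping.keys n \<subseteq> V" using assms(3) by (simp add: n(1) keys_add_nat)
    show "Poly_Mapping.single m c = Poly_Mapping.single n c * (Var i * Var j)" for c :: 'k
      by (simp add: n(1) Var_mult_Var mult_single add.assoc)
  qed
qed

lemma edge_ideal_eq:
  assumes "pair_graph G"
  shows "(edge_ideal G :: 'k::field mpoly set) = edge_monomial_ideal G 1"
proof
  interpret cring "mpoly_ring (pverts G) :: 'k mpoly ring" by (rule cring_mpoly_ring)
  have wf: "pair_wf_digraph G" using assms by (simp add: pair_graph_def pair_digraph_def pair_fin_digraph_def)
  interpret I: ideal "edge_ideal G :: 'k mpoly set" "mpoly_ring (pverts G)"
    by (rule ideal_edge_ideal[OF wf])
  note G = pair_graph_parcs[OF assms]
  have gen: "Var i * Var j \<in> (edge_ideal G :: 'k mpoly set)" if "(i, j) \<in> parcs G" for i j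
    unfolding edge_ideal_def genideal_def using that by blast
  show "edge_ideal G \<subseteq> (edge_monomial_ideal G 1 :: 'k mpoly set)"
    unfolding edge_ideal_def
  proof (rule genideal_minimal[OF ideal_edge_monomial_ideal], clarify)
    fix i j assume ij: "(i, j) \<in> parcs G"
    then have "i \<in> pverts G" "j \<in> pverts G" using G(4) by auto
    then show "Var i * Var j \<in> (edge_monomial_ideal G 1 :: 'k mpoly set)"
      using edge_multiple_1_edge[OF ij]
      by (simp add: Var_mult_Var mem_edge_monomial_ideal mem_mpoly_ring keys_add_nat)
  qed
  show "edge_monomial_ideal G 1 \<subseteq> (edge_ideal G :: 'k mpoly set)"
  proof
    fix f :: "'k mpoly" assume f: "f \<in> edge_monomial_ideal G 1"
    show "f \<in> edge_ideal G"
    proof (rule ideal_mem_if_monomials[OF I.is_ideal])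
      fix m assume m: "m \<in> Poly_Mapping.keys f"
      have "edge_multiple (parcs G) (Suc 0) m" "Poly_Mapping.keys m \<subseteq> pverts G"
        using f m by (auto simp: mem_edge_monomial_ideal mem_mpoly_ring)
      then obtain n i j where nij: "(i, j) \<in> parcs G" "Poly_Mapping.keys n \<subseteq> pverts G"
        "\<And>c :: 'k. Poly_Mapping.single m c = Poly_Mapping.single n c * (Var i * Var j)"
        using single_edge_multiple_split[OF _ G(4), where 'k = 'k] by metis
      show "Poly_Mapping.single m (Poly_Mapping.lookup f m) \<in> edge_ideal G"
        unfolding nij(3) using I.I_l_closed[OF gen[OF nij(1)] single_in_mpoly_ring[OF nij(2)]] by simp
    qed
  qed
qed

text \<open>Exponents add in products, which gives one inclusion. For the other, a monomial
  divisible by \<open>Suc t\<close> edges is one divisible by \<open>t\<close> edges times a single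
  edge.\<close>

lemma edge_ideal_power_eq:
  assumes "pair_graph G"
  shows "ideal_power (mpoly_ring (pverts G)) (edge_ideal G :: 'k::field mpoly set) t
    = edge_monomial_ideal G t"
proof (induction t)
  case 0
  show ?case by (auto simp: ideals_set_def mem_edge_monomial_ideal intro: edge_multiple.zero)
next
  case (Suc t)
  let ?R = "mpoly_ring (pverts G) :: 'k mpoly ring"
  interpret cring ?R by (rule cring_mpoly_ring)
  note G = pair_graph_parcs[OF assms]
  let ?P = "ideal_prod ?R (edge_monomial_ideal G t) (edge_monomial_ideal G 1)"
  have "?P = edge_monomial_ideal G (Suc t)"
  proof
    show "?P \<subseteq> edge_monomial_ideal G (Suc t)"
    proof
      fix f assume "f \<in> ?P"
      then show "f \<in> edge_monomial_ideal G (Suc t)"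
      proof (induction rule: ideal_prod.induct)
        case (prod a b)
        have "edge_multiple (parcs G) (Suc t) m" if "m \<in> Poly_Mapping.keys (a * b)" for m
        proof -
          from that obtain k l where "m = k + l" "k \<in> Poly_Mapping.keys a" "l \<in> Poly_Mapping.keys b"
            using Poly_Mapping.keys_mult[of a b] by blast
          then show ?thesis
            using edge_multiple_add[of "parcs G" t k 1 l] prod by (simp add: mem_edge_monomial_ideal)
        qed
        then show ?case
          using prod m_closed[of a b] by (simp add: mem_edge_monomial_ideal)
      next
        case (sum a b)
        then show ?case
          using additive_subgroup.a_closed[OF ideal.axioms(1)[OF ideal_edge_monomial_ideal]] by blast
      qed
    qed
    show "edge_monomial_ideal G (Suc t) \<subseteq> ?P"
    proof
      fix f :: "'k mpoly" assume f: "f \<in> edge_monomial_ideal G (Suc t)"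
      show "f \<in> ?P"
      proof (rule ideal_mem_if_monomials)
        show "ideal ?P ?R" by (intro ideal_prod_is_ideal ideal_edge_monomial_ideal)
        fix m assume m: "m \<in> Poly_Mapping.keys f"
        have "edge_multiple (parcs G) (Suc t) m" "Poly_Mapping.keys m \<subseteq> pverts G"
          using f m by (auto simp: mem_edge_monomial_ideal mem_mpoly_ring)
        then obtain n i j where nij: "edge_multiple (parcs G) t n" "(i, j) \<in> parcs G"
          "Poly_Mapping.keys n \<subseteq> pverts G"
          "\<And>c :: 'k. Poly_Mapping.single m c = Poly_Mapping.single n c * (Var i * Var j)"
          using single_edge_multiple_split[OF _ G(4), where 'k = 'k] by metis
        have "Poly_Mapping.single n c \<in> edge_monomial_ideal G t" for c :: 'k
          using nij(1,3) by (simp add: mem_edge_monomial_ideal single_in_mpoly_ring)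
        moreover have "Var i * Var j \<in> (edge_monomial_ideal G 1 :: 'k mpoly set)"
          using edge_multiple_1_edge[OF nij(2)] nij(2) G(4)
          by (auto simp: Var_mult_Var mem_edge_monomial_ideal mem_mpoly_ring keys_add_nat)
        ultimately show "Poly_Mapping.single m (Poly_Mapping.lookup f m) \<in> ?P"
          unfolding nij(4) using ideal_prod.prod[of _ _ _ _ ?R] by fastforce
      qed
    qed
  qed
  then show ?case
    using Suc.IH edge_ideal_eq[OF assms, where 'k = 'k] by (simp add: ideals_set_def)
qed

text \<open>Localizing at \<open>p\<close> amounts to allowing a multiplier \<open>u\<close> outside
  \<open>p\<close>, which may depend on \<open>p\<close>.\<close>

lemma mem_symbolic_power_edge_ideal:
  fixes f :: "'k::field mpoly"
  assumes "pair_graph G"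
  defines "R \<equiv> mpoly_ring (pverts G)"
  shows "f \<in> symbolic_power R (edge_ideal G) s \<longleftrightarrow> f \<in> carrier R
    \<and> (\<forall>p \<in> Ass R (edge_ideal G). \<exists>u \<in> carrier R - p. u * f \<in> edge_monomial_ideal G s)"
proof -
  have R: "R = ring_on (carrier R)" by (simp add: R_def mpoly_ring_def)
  have J: "ideal_power R (edge_ideal G :: 'k mpoly set) s = edge_monomial_ideal G s"
    unfolding R_def by (rule edge_ideal_power_eq[OF assms(1)])
  have "f \<in> contraction R (extension R p (ideal_power R (edge_ideal G) s))
      \<longleftrightarrow> f \<in> carrier R \<and> (\<exists>u \<in> carrier R - p. u * f \<in> edge_monomial_ideal G s)"
    if "p \<in> Ass R (edge_ideal G)" for p
  proof -
    have "primeideal p R" using that by (simp add: Ass_def)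
    then show ?thesis
      unfolding J
      by (intro contraction_extension_iff[of p "carrier R", unfolded R[symmetric]])
        (simp_all add: R_def ideal_edge_monomial_ideal)
  qed
  then show ?thesis by (auto simp: symbolic_power_def)
qed

text \<open>For a maximal independent set \<open>F\<close> the prime \<open>(x\<^sub>i : i \<notin> F)\<close> is the annihilator of the
  monomial \<open>\<Prod>j \<in> F. x\<^sub>j\<close> modulo the edge ideal.\<close>

lemma cover_ideal_in_Ass:
  assumes "pair_graph G" and F: "F \<subseteq> pverts G" "independent (parcs G) F"
    and max: "\<And>i. i \<in> pverts G - F \<Longrightarrow> \<exists>j \<in> F. (i, j) \<in> parcs G"
  shows "(monomial_ideal (pverts G) {m. \<exists>i \<in> pverts G - F. Poly_Mapping.lookup m i \<noteq> 0} :: 'k::field mpoly set)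
    \<in> Ass (mpoly_ring (pverts G)) (edge_ideal G)"
proof -
  let ?R = "mpoly_ring (pverts G) :: 'k mpoly ring"
  interpret cring ?R by (rule cring_mpoly_ring)
  note G = pair_graph_parcs[OF assms(1)]
  define C where "C = pverts G - F"
  define P where "P = (monomial_ideal (pverts G) {m. \<exists>i \<in> C. Poly_Mapping.lookup m i \<noteq> 0} :: 'k mpoly set)"
  \<comment> \<open>Membership in \<open>P\<close> means that every monomial has positive
    \<open>C\<close>-degree, which reduces primality to \<open>mult_low_degree\<close>.\<close>
  define deg where "deg m = sum (Poly_Mapping.lookup m) C" for m :: "nat \<Rightarrow>\<^sub>0 nat"
  have finC: "finite C" and finF: "finite F" using G(1) F(1) by (auto simp: C_def intro: finite_subset)
  have degP: "m \<in> {m. \<exists>i \<in> C. Poly_Mapping.lookup m i \<noteq> 0} \<longleftrightarrow> deg m \<noteq> 0" for m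
    using finC by (simp add: deg_def)
  have I: "ideal (edge_ideal G :: 'k mpoly set) ?R"
    unfolding edge_ideal_eq[OF assms(1)] by (rule ideal_edge_monomial_ideal)
  have memP: "f \<in> P \<longleftrightarrow> f \<in> carrier ?R \<and> (\<forall>m \<in> Poly_Mapping.keys f. deg m \<noteq> 0)" for f
    unfolding P_def monomial_ideal_def using degP by blast
  have "ideal P ?R" unfolding P_def by (rule ideal_monomial_ideal) (auto simp: lookup_add)
  then have prime: "primeideal P ?R"
  proof (rule primeidealI)
    show "cring ?R" by (rule is_cring)
    have "(1 :: 'k mpoly) \<notin> P" by (simp add: memP deg_def)
    then show "carrier ?R \<noteq> P" using one_closed by force
    fix a b assume ab: "a \<in> carrier ?R" "b \<in> carrier ?R" "a \<otimes>\<^bsub>?R\<^esub> b \<in> P"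
    show "a \<in> P \<or> b \<in> P"
    proof (rule ccontr)
      assume "\<not> (a \<in> P \<or> b \<in> P)"
      then obtain m n where mn: "m \<in> Poly_Mapping.keys a" "deg m = 0" "n \<in> Poly_Mapping.keys b" "deg n = 0"
        using ab memP by blast
      have "\<exists>k \<in> Poly_Mapping.keys (a * b). deg k \<le> deg m + deg n"
        using mn(1,3) by (intro mult_low_degree) (auto simp: deg_def lookup_add sum.distrib)
      then show False using mn(2,4) ab(3) memP by auto
    qed
  qed
  define \<chi> where "\<chi> = (\<Sum>j \<in> F. Poly_Mapping.single j (1::nat))"
  have lookup_\<chi>: "Poly_Mapping.lookup \<chi> j = (if j \<in> F then 1 else 0)" for j
    using finF by (simp add: \<chi>_def lookup_sum lookup_single when_def)
  have \<chi>V: "Poly_Mapping.keys \<chi> \<subseteq> pverts G"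
    using F(1) by (auto simp: in_keys_iff lookup_\<chi> split: if_splits)
  define h where "h = (Poly_Mapping.single \<chi> 1 :: 'k mpoly)"
  have h: "h \<in> carrier ?R" unfolding h_def by (rule single_in_mpoly_ring[OF \<chi>V])
  \<comment> \<open>\<open>F\<close> contains no edge, while maximality joins each vertex of
    \<open>C\<close> to \<open>F\<close>. So adding \<open>\<chi>\<close> creates an edge exactly
    when \<open>m\<close> involves \<open>C\<close>.\<close>
  have em: "edge_multiple (parcs G) 1 (m + \<chi>) \<longleftrightarrow> deg m \<noteq> 0" if m: "Poly_Mapping.keys m \<subseteq> pverts G" for m
  proof
    assume "edge_multiple (parcs G) 1 (m + \<chi>)"
    then obtain i j where ij: "(i, j) \<in> parcs G" "Poly_Mapping.lookup (m + \<chi>) i \<noteq> 0"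
      "Poly_Mapping.lookup (m + \<chi>) j \<noteq> 0" using edge_multiple_1_iff[OF G(3)] by blast
    show "deg m \<noteq> 0"
    proof
      assume "deg m = 0"
      then have "Poly_Mapping.lookup m k = 0" if "k \<in> C" for k using that finC by (simp add: deg_def)
      moreover have "i \<in> C \<union> F" "j \<in> C \<union> F" using ij(1) G(4) by (auto simp: C_def)
      ultimately have "i \<in> F" "j \<in> F" using ij by (auto simp: lookup_add lookup_\<chi> C_def split: if_splits)
      then show False using F(2) ij(1) by (auto simp: independent_def)
    qed
  next
    assume "deg m \<noteq> 0"
    then obtain i where i: "i \<in> C" "Poly_Mapping.lookup m i \<noteq> 0" using degP by blast
    then obtain j where "j \<in> F" "(i, j) \<in> parcs G" using max by (auto simp: C_def)
    then show "edge_multiple (parcs G) 1 (m + \<chi>)"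
      using i edge_multiple_1_iff[OF G(3)] by (fastforce simp: lookup_add lookup_\<chi>)
  qed
  have "P = {g \<in> carrier ?R. g \<otimes>\<^bsub>?R\<^esub> h \<in> edge_ideal G}"
  proof -
    have "g * h \<in> edge_ideal G \<longleftrightarrow> (\<forall>m \<in> Poly_Mapping.keys g. deg m \<noteq> 0)" if g: "g \<in> carrier ?R" for g
      using m_closed[OF g h] em g
      by (simp add: edge_ideal_eq[OF assms(1)] mem_edge_monomial_ideal h_def keys_mult_single mem_mpoly_ring)
    then show ?thesis by (auto simp: memP)
  qed
  then have "P \<in> Ass ?R (edge_ideal G)"
    unfolding Ass_iff[OF I is_cring] using prime h by blast
  then show ?thesis by (simp add: P_def C_def)
qed

text \<open>Enlarge \<open>F\<close> to a maximal independent set with complement \<open>C\<close>.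
  Some \<open>u\<close> outside the prime of \<open>C\<close> takes \<open>f\<close> into the
  \<open>s\<close>-th power. As \<open>u\<close> has a monomial free of \<open>C\<close>, some
  monomial of \<open>u * f\<close> has \<open>C\<close>-degree at most that of \<open>m\<close>, yet
  at least \<open>s\<close> because \<open>C\<close> covers all edges.\<close>

lemma symbolic_power_exponents:
  fixes f :: "'k::field mpoly"
  assumes "pair_graph G" and f: "f \<in> symbolic_power (mpoly_ring (pverts G)) (edge_ideal G) s"
    and m: "m \<in> Poly_Mapping.keys f" and F: "F \<subseteq> pverts G" "independent (parcs G) F"
  shows "s \<le> sum (Poly_Mapping.lookup m) (pverts G - F)"
proof -
  note G = pair_graph_parcs[OF assms(1)]
  define \<F> where "\<F> = {F. F \<subseteq> pverts G \<and> independent (parcs G) F}"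
  have "finite \<F>" using G(1) by (auto simp: \<F>_def intro: finite_subset[of _ "Pow (pverts G)"])
  moreover have "F \<in> \<F>" using F by (simp add: \<F>_def)
  ultimately obtain M where M: "M \<in> \<F>" "F \<subseteq> M" "\<forall>B \<in> \<F>. M \<subseteq> B \<longrightarrow> M = B"
    using finite_has_maximal2 by metis
  have max: "\<exists>j \<in> M. (i, j) \<in> parcs G" if i: "i \<in> pverts G - M" for i
  proof (rule ccontr)
    assume no: "\<not> ?thesis"
    have "independent (parcs G) (insert i M)"
      using no M(1) G(2,3) unfolding \<F>_def independent_def by (auto dest: symD irreflD)
    then have "insert i M \<in> \<F>" using i M(1) by (simp add: \<F>_def)
    then show False using M(3) i by blast
  qed
  define C where "C = pverts G - M"
  have M': "M \<subseteq> pverts G" "independent (parcs G) M" using M(1) by (auto simp: \<F>_def)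
  let ?P = "monomial_ideal (pverts G) {m. \<exists>i \<in> C. Poly_Mapping.lookup m i \<noteq> 0} :: 'k mpoly set"
  have "?P \<in> Ass (mpoly_ring (pverts G)) (edge_ideal G)"
    unfolding C_def by (rule cover_ideal_in_Ass[OF assms(1) M' max])
  then obtain u where u: "u \<in> carrier (mpoly_ring (pverts G))" "u \<notin> ?P" "u * f \<in> edge_monomial_ideal G s"
    using f mem_symbolic_power_edge_ideal[OF assms(1), of f s] by blast
  then obtain n where n: "n \<in> Poly_Mapping.keys u" "\<forall>i \<in> C. Poly_Mapping.lookup n i = 0"
    unfolding monomial_ideal_def by blast
  have "\<exists>k \<in> Poly_Mapping.keys (u * f). sum (Poly_Mapping.lookup k) C
      \<le> sum (Poly_Mapping.lookup n) C + sum (Poly_Mapping.lookup m) C"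
    using n(1) m by (intro mult_low_degree) (auto simp: lookup_add sum.distrib)
  then obtain k where k: "k \<in> Poly_Mapping.keys (u * f)"
    "sum (Poly_Mapping.lookup k) C \<le> sum (Poly_Mapping.lookup m) C" using n(2) by auto
  have "s \<le> sum (Poly_Mapping.lookup k) C"
  proof (rule edge_multiple_cover)
    show "edge_multiple (parcs G) s k" using k(1) u(3) by (simp add: mem_edge_monomial_ideal)
    show "finite C" using G(1) by (simp add: C_def)
    show "i \<in> C \<or> j \<in> C" if "(i, j) \<in> parcs G" for i j
      using that G(4) M'(2) by (auto simp: C_def independent_def)
  qed
  also note k(2)
  also have "sum (Poly_Mapping.lookup m) C \<le> sum (Poly_Mapping.lookup m) (pverts G - F)"
    using G(1) M(2) by (intro sum_mono2) (auto simp: C_def)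
  finally show ?thesis .
qed

text \<open>If \<open>x\<^sub>i\<close> lies in an associated prime \<open>p = (I : h)\<close>, then \<open>i\<close> has a neighbour \<open>\<phi>(i)\<close> in the
  support of a monomial of \<open>h\<close> outside \<open>I\<close>, and \<open>x\<^bsub>\<phi>(i)\<^esub> \<notin> p\<close>. Thus \<open>x\<^sub>i\<close> may be multiplied into
  \<open>I\<close> by a unit of the localization.\<close>

lemma monomial_in_symbolic_power:
  assumes "pair_graph G" and m: "Poly_Mapping.keys m \<subseteq> pverts G"
    and cover: "\<And>F. F \<subseteq> pverts G \<Longrightarrow> independent (parcs G) F
      \<Longrightarrow> s \<le> sum (Poly_Mapping.lookup m) (pverts G - F)"
  shows "(Poly_Mapping.single m 1 :: 'k::field mpoly)
    \<in> symbolic_power (mpoly_ring (pverts G)) (edge_ideal G) s"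
proof -
  let ?R = "mpoly_ring (pverts G) :: 'k mpoly ring"
  note G = pair_graph_parcs[OF assms(1)]
  have I: "ideal (edge_ideal G :: 'k mpoly set) ?R"
    unfolding edge_ideal_eq[OF assms(1)] by (rule ideal_edge_monomial_ideal)
  interpret I: ideal "edge_ideal G :: 'k mpoly set" ?R by (rule I)
  have "\<exists>u \<in> carrier ?R - p. u * Poly_Mapping.single m 1 \<in> edge_monomial_ideal G s"
    if pA: "p \<in> Ass ?R (edge_ideal G)" for p
  proof -
    have p: "primeideal p ?R" using pA by (simp add: Ass_def)
    interpret primeideal p ?R by (rule p)
    obtain h where h: "h \<in> carrier ?R" "p = {g \<in> carrier ?R. g \<otimes>\<^bsub>?R\<^esub> h \<in> edge_ideal G}"
      using pA unfolding Ass_iff[OF I is_cring] by blast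
    have memp: "g \<in> p \<longleftrightarrow> g \<in> carrier ?R \<and> g * h \<in> edge_ideal G" for g
      by (subst h(2)) simp
    have Var: "(Var i :: 'k mpoly) \<in> carrier ?R" if "i \<in> pverts G" for i
      using that by (rule Var_in_mpoly_ring)
    \<comment> \<open>Primality makes \<open>C\<close> a vertex cover: for each edge, the variable
      of one end lies in \<open>p\<close>.\<close>
    define C where "C = {i \<in> pverts G. (Var i :: 'k mpoly) \<in> p}"
    have finC: "finite C" using G(1) by (simp add: C_def)
    have "independent (parcs G) (pverts G - C)"
      unfolding independent_def
    proof (intro ballI notI)
      fix i j assume ij: "i \<in> pverts G - C" "j \<in> pverts G - C" "(i, j) \<in> parcs G"
      have "Var i * Var j \<in> (edge_ideal G :: 'k mpoly set)"
        unfolding edge_ideal_def genideal_def using ij(3) by blast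
      then have "(Var i * Var j) * h \<in> edge_ideal G"
        using I.I_r_closed[OF _ h(1)] by simp
      moreover have "Var i * Var j \<in> carrier ?R"
        using I.m_closed[OF Var Var, of i j] ij by simp
      ultimately have "Var i \<otimes>\<^bsub>?R\<^esub> Var j \<in> p" by (simp add: memp)
      then show False using I_prime[OF Var Var, of i j] ij by (auto simp: C_def)
    qed
    then have "s \<le> sum (Poly_Mapping.lookup m) (pverts G - (pverts G - C))" by (intro cover) auto
    also have "pverts G - (pverts G - C) = C" by (auto simp: C_def)
    finally have sC: "s \<le> sum (Poly_Mapping.lookup m) C" .
    have one: "(1 :: 'k mpoly) \<in> carrier ?R"
      using I.one_closed by (simp only: mpoly_ring_simps)
    have "(1 :: 'k mpoly) \<notin> p"
      using one_imp_carrier I_notcarr unfolding mpoly_ring_simps by blast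
    then have "h \<notin> edge_ideal G" using memp[of 1] one by (simp only: mult_1) blast
    then obtain k where k: "k \<in> Poly_Mapping.keys h" "\<not> edge_multiple (parcs G) 1 k"
      using h(1) by (auto simp: edge_ideal_eq[OF assms(1)] mem_edge_monomial_ideal)
    have k_indep: False if "(i, j) \<in> parcs G" "Poly_Mapping.lookup k i \<noteq> 0" "Poly_Mapping.lookup k j \<noteq> 0" for i j
      using that k(2) edge_multiple_1_iff[OF G(3)] by blast
    have nbr: "\<exists>j. (i, j) \<in> parcs G \<and> Poly_Mapping.lookup k j \<noteq> 0" if i: "i \<in> C" for i
    proof -
      have "h * Var i \<in> edge_ideal G" using i by (simp add: C_def memp mult.commute)
      moreover have "k + Poly_Mapping.single i 1 \<in> Poly_Mapping.keys (h * Var i)"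
        using k(1) by (simp add: Var_def keys_mult_single)
      ultimately have "edge_multiple (parcs G) 1 (k + Poly_Mapping.single i 1)"
        by (simp add: edge_ideal_eq[OF assms(1)] mem_edge_monomial_ideal)
      then obtain a b where ab: "(a, b) \<in> parcs G" "Poly_Mapping.lookup (k + Poly_Mapping.single i 1) a \<noteq> 0"
        "Poly_Mapping.lookup (k + Poly_Mapping.single i 1) b \<noteq> 0"
        using edge_multiple_1_iff[OF G(3)] by blast
      have "a \<noteq> b" using ab(1) G(3) by (auto simp: irrefl_def)
      then show ?thesis
        using ab k_indep[OF ab(1)] G(2)
        by (auto simp: lookup_add lookup_single when_def dest: symD split: if_splits)
    qed
    have "\<exists>j. (i, j) \<in> parcs G \<and> j \<notin> C" if i: "i \<in> C" for i
    proof -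
      obtain j where j: "(i, j) \<in> parcs G" "Poly_Mapping.lookup k j \<noteq> 0" using nbr[OF i] by blast
      \<comment> \<open>Otherwise \<open>j\<close> would have a neighbour in the support of
        \<open>k\<close>, giving an edge inside that support.\<close>
      have "j \<notin> C" using nbr[of j] k_indep j(2) by blast
      then show ?thesis using j(1) by blast
    qed
    then obtain \<phi> where \<phi>: "\<And>i. i \<in> C \<Longrightarrow> (i, \<phi> i) \<in> parcs G" "\<And>i. i \<in> C \<Longrightarrow> \<phi> i \<notin> C" by metis
    \<comment> \<open>Each \<open>i\<close> in \<open>C\<close> is paired with
      \<open>\<phi> i\<close>, as often as its exponent in \<open>m\<close>, so \<open>w + m\<close>
      contains at least \<open>s\<close> edges. Primality keeps \<open>x^w\<close> outside
      \<open>p\<close>, since no \<open>\<phi> i\<close> lies in \<open>C\<close>.\<close>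
    define w where "w = (\<Sum>i \<in> C. Poly_Mapping.single (\<phi> i) (Poly_Mapping.lookup m i))"
    have w_keys: "Poly_Mapping.keys w \<subseteq> \<phi> ` C"
    proof
      fix j assume "j \<in> Poly_Mapping.keys w"
      then have "(\<Sum>i \<in> C. Poly_Mapping.lookup (Poly_Mapping.single (\<phi> i) (Poly_Mapping.lookup m i)) j) \<noteq> 0"
        by (simp add: w_def in_keys_iff lookup_sum)
      then obtain i where "i \<in> C" "Poly_Mapping.lookup (Poly_Mapping.single (\<phi> i) (Poly_Mapping.lookup m i)) j \<noteq> 0"
        by (meson sum.neutral)
      then show "j \<in> \<phi> ` C" by (auto simp: lookup_single when_def split: if_splits)
    qed
    then have wV: "Poly_Mapping.keys w \<subseteq> pverts G" using \<phi>(1) G(4) by blast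
    have "Poly_Mapping.single w (1::'k) \<notin> p"
    proof
      assume "Poly_Mapping.single w (1::'k) \<in> p"
      from primeideal_monomial[OF p wV this] obtain j where "j \<in> Poly_Mapping.keys w" "(Var j :: 'k mpoly) \<in> p" by blast
      then show False using w_keys wV \<phi>(2) by (auto simp: C_def)
    qed
    moreover have "Poly_Mapping.single w (1::'k) \<in> carrier ?R" by (rule single_in_mpoly_ring[OF wV])
    moreover have "Poly_Mapping.single w 1 * Poly_Mapping.single m 1 \<in> (edge_monomial_ideal G s :: 'k mpoly set)"
    proof -
      have "edge_multiple (parcs G) (sum (Poly_Mapping.lookup m) C)
          (\<Sum>i \<in> C. Poly_Mapping.single i (Poly_Mapping.lookup m i)
            + Poly_Mapping.single (\<phi> i) (Poly_Mapping.lookup m i))"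
        using finC by (intro edge_multiple_sum edge_multiple_single \<phi>(1))
      then have "edge_multiple (parcs G) (sum (Poly_Mapping.lookup m) C) (w + m)"
      proof (rule edge_multiple_le)
        fix j
        have "(\<Sum>i \<in> C. Poly_Mapping.lookup (Poly_Mapping.single i (Poly_Mapping.lookup m i)) j)
            \<le> Poly_Mapping.lookup m j"
          using finC by (simp add: lookup_single when_def)
        then show "Poly_Mapping.lookup (\<Sum>i \<in> C. Poly_Mapping.single i (Poly_Mapping.lookup m i)
            + Poly_Mapping.single (\<phi> i) (Poly_Mapping.lookup m i)) j \<le> Poly_Mapping.lookup (w + m) j"
          by (simp add: sum.distrib lookup_add w_def lookup_sum)
      qed
      then have "edge_multiple (parcs G) s (w + m)" using sC edge_multiple_mono by blast
      then show ?thesis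
        using m wV by (simp add: mult_single mem_edge_monomial_ideal single_in_mpoly_ring keys_add_nat)
    qed
    ultimately show ?thesis by blast
  qed
  then show ?thesis
    using mem_symbolic_power_edge_ideal[OF assms(1), of "Poly_Mapping.single m 1 :: 'k mpoly" s]
      single_in_mpoly_ring[OF m] by blast
qed

section \<open>The circulant graph and its resurgence\<close>

lemma int_mod_small:
  fixes z n :: int
  assumes "- n < z" "z < n"
  shows "z mod n = (if 0 \<le> z then z else z + n)"
proof (cases "0 \<le> z")
  case False
  then have "(z + n) mod n = z + n" using assms by (intro mod_pos_pos_trivial) auto
  then show ?thesis using False by simp
qed (use assms in simp)

definition cyc_dist :: "nat \<Rightarrow> nat \<Rightarrow> nat \<Rightarrow> int" where
  "cyc_dist n i j = (int j - int i) mod int n"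

text \<open>Measuring from a base vertex \<open>v\<close> turns questions on the cycle into integer
  inequalities.\<close>

lemma cyc_dist_diff: "cyc_dist n i j = (cyc_dist n v j - cyc_dist n v i) mod int n"
  by (simp add: cyc_dist_def mod_diff_eq)

lemma cyc_dist_bounds: "0 < n \<Longrightarrow> 0 \<le> cyc_dist n i j \<and> cyc_dist n i j < int n"
  by (simp add: cyc_dist_def)

lemma cyc_dist_eq_0_iff:
  assumes "i \<in> {1..n}" "j \<in> {1..n}"
  shows "cyc_dist n i j = 0 \<longleftrightarrow> i = j"
  using assms int_mod_small[of "int n" "int j - int i"] by (auto simp: cyc_dist_def split: if_splits)

lemma G_graph_arc_cyc_dist:
  assumes "i \<in> {1..n}" "j \<in> {1..n}"
  shows "(i, j) \<in> parcs (G_graph n r)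
    \<longleftrightarrow> int r < cyc_dist n i j \<and> cyc_dist n i j < int n - int r"
proof -
  have dist: "cyc_dist n i j = (if i \<le> j then int j - int i else int j - int i + int n)"
    unfolding cyc_dist_def using assms by (subst int_mod_small) auto
  consider "i < j" | "i = j" | "j < i" by linarith
  then show ?thesis
  proof cases
    case 1
    then show ?thesis using G_graph_arc_iff[of i j n r] assms dist by auto
  next
    case 2
    then show ?thesis using dist by (simp add: G_graph_def)
  next
    case 3
    have "(i, j) \<in> parcs (G_graph n r) \<longleftrightarrow> (j, i) \<in> parcs (G_graph n r)"
      using pair_graph_parcs(2)[OF pair_graph_G_graph] by (meson symD)
    then show ?thesis using 3 G_graph_arc_iff[of j i n r] assms dist by auto
  qed
qed

section \<open>Windows of consecutive vertices\<close>

definition forward_window :: "nat \<Rightarrow> nat \<Rightarrow> nat \<Rightarrow> nat set" where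
  "forward_window n r v = {j \<in> {1..n}. cyc_dist n v j \<le> int r}"

text \<open>Distance \<open>0\<close> is listed separately because \<open>v\<close>, the last vertex
  of this window, has distance \<open>0\<close> rather than \<open>n\<close>.\<close>

definition backward_window :: "nat \<Rightarrow> nat \<Rightarrow> nat \<Rightarrow> nat set" where
  "backward_window n r v = {j \<in> {1..n}. cyc_dist n v j = 0 \<or> int n - int r \<le> cyc_dist n v j}"

text \<open>The hypothesis for both orders of a pair puts the cyclic distance outside the range of
  edges, whichever of the two comes first after \<open>v\<close>.\<close>

lemma independent_if_close:
  assumes "F \<subseteq> {1..n}" "0 < n"
    and close: "\<And>i j. i \<in> F \<Longrightarrow> j \<in> F \<Longrightarrow> cyc_dist n v j - cyc_dist n v i \<le> int r
      \<or> int n - int r \<le> cyc_dist n v j - cyc_dist n v i"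
  shows "independent (parcs (G_graph n r)) F"
  unfolding independent_def
proof (intro ballI)
  fix i j assume ij: "i \<in> F" "j \<in> F"
  define a b where "a = cyc_dist n v i" and "b = cyc_dist n v j"
  have "cyc_dist n i j = (b - a) mod int n"
    unfolding a_def b_def by (rule cyc_dist_diff)
  also have "\<dots> = (if 0 \<le> b - a then b - a else b - a + int n)"
    using cyc_dist_bounds[OF assms(2), of v] unfolding a_def b_def
    by (intro int_mod_small) (smt (verit))+
  finally have "cyc_dist n i j = (if 0 \<le> b - a then b - a else b - a + int n)" .
  moreover have "i \<in> {1..n}" "j \<in> {1..n}" using ij assms(1) by blast+
  ultimately show "(i, j) \<notin> parcs (G_graph n r)"
    using close[OF ij] close[OF ij(2,1)] G_graph_arc_cyc_dist[of i n j r]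
    unfolding a_def[symmetric] b_def[symmetric] by (auto split: if_splits)
qed

lemma independent_forward_window:
  assumes "0 < n"
  shows "independent (parcs (G_graph n r)) (forward_window n r v)"
proof (rule independent_if_close[where v = v])
  fix i j assume "i \<in> forward_window n r v" "j \<in> forward_window n r v"
  then show "cyc_dist n v j - cyc_dist n v i \<le> int r \<or> int n - int r \<le> cyc_dist n v j - cyc_dist n v i"
    using cyc_dist_bounds[OF assms, of v i] by (auto simp: forward_window_def)
qed (use assms in \<open>auto simp: forward_window_def\<close>)

lemma independent_backward_window:
  assumes "r < n"
  shows "independent (parcs (G_graph n r)) (backward_window n r v)"
proof (rule independent_if_close[where v = v])
  fix i j assume "i \<in> backward_window n r v" "j \<in> backward_window n r v"
  then show "cyc_dist n v j - cyc_dist n v i \<le> int r \<or> int n - int r \<le> cyc_dist n v j - cyc_dist n v i"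
    using cyc_dist_bounds[of n v j] assms by (auto simp: backward_window_def)
qed (use assms in \<open>auto simp: backward_window_def\<close>)

text \<open>A non-neighbour lies at most \<open>r\<close> steps ahead of \<open>v\<close> or at most
  \<open>r\<close> steps behind it; the two windows share \<open>v\<close>.\<close>

lemma bipartite_nonneighbours:
  assumes "r < n" "v \<in> {1..n}"
  shows "bipartite (parcs (G_graph n r)) {u \<in> {1..n}. (v, u) \<notin> parcs (G_graph n r)}"
  unfolding bipartite_def
proof (intro exI conjI)
  show "independent (parcs (G_graph n r)) (forward_window n r v)"
    using assms(1) by (intro independent_forward_window) simp
  show "independent (parcs (G_graph n r)) (backward_window n r v)"
    using assms(1) by (rule independent_backward_window)
  show "{u \<in> {1..n}. (v, u) \<notin> parcs (G_graph n r)} \<subseteq> forward_window n r v \<union> backward_window n r v"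
    using assms(2) by (auto simp: forward_window_def backward_window_def G_graph_arc_cyc_dist)
qed

text \<open>The windows starting at \<open>j\<close> and at the \<open>r\<close> vertices before it
  contain \<open>j\<close>; \<open>g d\<close> is the vertex \<open>d\<close> steps back.\<close>

lemma card_windows_through:
  assumes "r < n" and j: "j \<in> {1..n}"
  shows "r + 1 \<le> card {v \<in> {1..n}. j \<in> forward_window n r v}"
proof -
  define g where "g d = (if d < j then j - d else j + n - d)" for d
  have dist: "cyc_dist n (g d) j = int d" if "d \<le> r" for d
    using that assms unfolding g_def cyc_dist_def
    by (subst int_mod_small) auto
  have "inj_on g {..r}" by (rule inj_onI) (metis atMost_iff dist of_nat_eq_iff)
  then have "r + 1 = card (g ` {..r})" by (simp add: card_image)
  also have "\<dots> \<le> card {v \<in> {1..n}. j \<in> forward_window n r v}"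
  proof (intro card_mono subsetI)
    fix v assume "v \<in> g ` {..r}"
    then obtain d where d: "d \<le> r" "v = g d" by auto
    then have "v \<in> {1..n}" using assms by (auto simp: g_def)
    then show "v \<in> {v \<in> {1..n}. j \<in> forward_window n r v}"
      using dist[OF d(1)] d j by (auto simp: forward_window_def)
  qed simp
  finally show ?thesis .
qed

text \<open>The cover inequalities of the \<open>n\<close> windows are summed; each vertex lies in
  at least \<open>r + 1\<close> of them.\<close>

lemma cover_average:
  fixes w :: "nat \<Rightarrow> nat"
  assumes "r < n"
    and cover: "\<And>F. F \<subseteq> {1..n} \<Longrightarrow> independent (parcs (G_graph n r)) F \<Longrightarrow> s \<le> sum w ({1..n} - F)"
  shows "n * s + (r + 1) * sum w {1..n} \<le> n * sum w {1..n}"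
proof -
  have window: "s + sum w (forward_window n r v) \<le> sum w {1..n}" for v
  proof -
    have sub: "forward_window n r v \<subseteq> {1..n}" by (auto simp: forward_window_def)
    have "s \<le> sum w ({1..n} - forward_window n r v)"
      using sub assms(1) by (intro cover independent_forward_window) auto
    then show ?thesis using sum.subset_diff[OF sub, of w] by simp
  qed
  have "(r + 1) * sum w {1..n} = (\<Sum>j \<in> {1..n}. (r + 1) * w j)"
    by (simp add: sum_distrib_left)
  also have "\<dots> \<le> (\<Sum>j \<in> {1..n}. card {v \<in> {1..n}. j \<in> forward_window n r v} * w j)"
    using card_windows_through[OF assms(1)] by (intro sum_mono mult_right_mono) auto
  also have "\<dots> = (\<Sum>j \<in> {1..n}. \<Sum>v | v \<in> {1..n} \<and> j \<in> forward_window n r v. w j)"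
    by simp
  also have "\<dots> = (\<Sum>v \<in> {1..n}. \<Sum>j | j \<in> {1..n} \<and> j \<in> forward_window n r v. w j)"
    by (rule sum.swap_restrict) auto
  also have "\<dots> = (\<Sum>v \<in> {1..n}. sum w (forward_window n r v))"
    by (intro sum.cong refl arg_cong2[where f = sum]) (auto simp: forward_window_def)
  finally have "n * s + (r + 1) * sum w {1..n} \<le> (\<Sum>v \<in> {1..n}. s + sum w (forward_window n r v))"
    by (simp add: sum.distrib)
  also have "\<dots> \<le> (\<Sum>v \<in> {1..n}. sum w {1..n})" by (intro sum_mono window)
  finally show ?thesis by simp
qed

text \<open>Seen from a vertex \<open>f\<close> of \<open>F\<close>, all members are at distance
  \<open>0..r\<close> or \<open>n - r..n - 1\<close>. Shifting the second range by
  \<open>n - r - 1\<close> moves it into \<open>1..r\<close>, so \<open>F\<close> injects into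
  \<open>r + 1\<close> values.\<close>

lemma card_independent_le:
  assumes n: "2 * r + 2 \<le> n" and F: "F \<subseteq> {1..n}" "independent (parcs (G_graph n r)) F"
  shows "card F \<le> r + 1"
proof (cases "F = {}")
  case False
  then obtain f where f: "f \<in> F" by blast
  define y where "y x = cyc_dist n f x" for x
  \<comment> \<open>\<open>h\<close> identifies the two ends of a pair at distance \<open>n - r - 1\<close>, of which \<open>F\<close> contains
    at most one.\<close>
  define h where "h x = (if y x \<le> int r then y x else y x - (int n - int r - 1))" for x
  have y: "0 \<le> y x" "y x < int n" for x using cyc_dist_bounds[of n f x] n by (auto simp: y_def)
  have far: "y x \<le> int r \<or> int n - int r \<le> y x" if "x \<in> F" for x
    using G_graph_arc_cyc_dist[of f n x r] F f that by (force simp: independent_def y_def)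
  have dist: "cyc_dist n x x' = (y x' - y x) mod int n" for x x'
    unfolding y_def by (rule cyc_dist_diff)
  \<comment> \<open>The distance \<open>n - r - 1\<close> is that of an edge because
    \<open>n \<ge> 2 * r + 2\<close>.\<close>
  have mixed: False if xx: "x \<in> F" "x' \<in> F" "y x' - y x = int n - int r - 1" for x x'
  proof -
    have "cyc_dist n x x' = int n - int r - 1"
      unfolding dist xx(3) using n by (intro mod_pos_pos_trivial) auto
    moreover have "x \<in> {1..n}" "x' \<in> {1..n}" using xx(1,2) F(1) by blast+
    ultimately have "(x, x') \<in> parcs (G_graph n r)"
      using G_graph_arc_cyc_dist[of x n x' r] n by auto
    then show False using F(2) xx by (auto simp: independent_def)
  qed
  have "inj_on h F"
  proof (rule inj_onI)
    fix x x' assume x: "x \<in> F" "x' \<in> F" "h x = h x'"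
    then have "y x = y x'"
      using mixed[of x x'] mixed[of x' x] by (auto simp: h_def split: if_splits)
    then have "cyc_dist n x x' = 0" by (simp add: dist)
    then show "x = x'" using cyc_dist_eq_0_iff[of x n x'] x F(1) by blast
  qed
  moreover have "h x \<in> {0..int r}" if "x \<in> F" for x
    using far[OF that] y[of x] by (auto simp: h_def)
  then have "h ` F \<subseteq> {0..int r}" by blast
  ultimately have "card F \<le> card {0..int r}" by (intro card_inj_on_le) auto
  then show ?thesis by simp
qed simp

section \<open>Containments between powers, and the supremum\<close>

lemma edge_multiple_size:
  assumes "edge_multiple E t m" "finite V" "E \<subseteq> V \<times> V"
  shows "2 * t \<le> sum (Poly_Mapping.lookup m) V"
  using assms(1)
proof (induction rule: edge_multiple.induct)
  case (Suc t m i j)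
  then have "i \<in> V" "j \<in> V" using assms(3) by auto
  then show ?case using Suc.IH assms(2) by (simp add: lookup_add sum.distrib lookup_single when_def)
qed simp

lemma symbolic_power_subset_power:
  assumes n: "2 * r + 2 \<le> n" and st: "2 * (n - (r + 1)) * t < n * s"
  shows "symbolic_power (mpoly_ring {1..n}) (edge_ideal (G_graph n r) :: 'k::field mpoly set) s
    \<subseteq> ideal_power (mpoly_ring {1..n}) (edge_ideal (G_graph n r)) t"
proof
  let ?G = "G_graph n r"
  have V: "pverts ?G = {1..n}" by (simp add: G_graph_def)
  have pg: "pair_graph ?G" by (rule pair_graph_G_graph)
  fix f :: "'k mpoly" assume f: "f \<in> symbolic_power (mpoly_ring {1..n}) (edge_ideal ?G) s"
  have "edge_multiple (parcs ?G) t m" if m: "m \<in> Poly_Mapping.keys f" for m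
  proof (rule edge_multiple_if_covers)
    show cover: "s \<le> sum (Poly_Mapping.lookup m) ({1..n} - F)"
      if "F \<subseteq> {1..n}" "independent (parcs ?G) F" for F
      using symbolic_power_exponents[OF pg, of f s m F] f m that by (simp add: V)
    \<comment> \<open>Since \<open>n \<ge> 2 * r + 2\<close>, the threshold for \<open>s / t\<close>
      is at least 1.\<close>
    have "n * t \<le> 2 * (n - (r + 1)) * t" using n by (intro mult_right_mono) auto
    then have "n * t < n * s" using st by linarith
    then show "t \<le> s" by simp
    define W where "W = sum (Poly_Mapping.lookup m) {1..n}"
    have "n * s + (r + 1) * W \<le> n * W"
      unfolding W_def using n by (intro cover_average cover) auto
    then have W: "n * s \<le> (n - (r + 1)) * W" by (simp add: diff_mult_distrib)
    have "(n - (r + 1)) * (2 * t) = 2 * (n - (r + 1)) * t" by simp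
    also note st
    also note W
    finally have "2 * t < W" by simp
    then show "2 * t \<le> sum (Poly_Mapping.lookup m) {1..n}" by (simp add: W_def)
    show "bipartite (parcs ?G) {u \<in> {1..n}. (v, u) \<notin> parcs ?G}" if "v \<in> {1..n}" for v
      using n that by (intro bipartite_nonneighbours) auto
  qed (use pair_graph_parcs[OF pg] in \<open>simp_all add: V\<close>)
  moreover have "f \<in> carrier (mpoly_ring {1..n})" using f by (simp add: symbolic_power_def)
  ultimately show "f \<in> ideal_power (mpoly_ring {1..n}) (edge_ideal ?G) t"
    using edge_ideal_power_eq[OF pg, of t, where 'k = 'k] by (simp add: V mem_edge_monomial_ideal)
qed

text \<open>The witness is \<open>(x_1 ... x_n)^(2k)\<close>. Its weight off any independent set is
  at least \<open>2k(n - r - 1)\<close>, but its degree \<open>2nk\<close> is too small for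
  \<open>nk + 1\<close> edges.\<close>

lemma symbolic_power_not_subset_power:
  assumes n: "2 * r + 2 \<le> n"
  shows "\<not> symbolic_power (mpoly_ring {1..n}) (edge_ideal (G_graph n r) :: 'k::field mpoly set)
      (2 * k * (n - (r + 1)))
    \<subseteq> ideal_power (mpoly_ring {1..n}) (edge_ideal (G_graph n r)) (n * k + 1)"
proof
  let ?G = "G_graph n r"
  have V: "pverts ?G = {1..n}" by (simp add: G_graph_def)
  have pg: "pair_graph ?G" by (rule pair_graph_G_graph)
  assume sub: "symbolic_power (mpoly_ring {1..n}) (edge_ideal ?G :: 'k mpoly set) (2 * k * (n - (r + 1)))
    \<subseteq> ideal_power (mpoly_ring {1..n}) (edge_ideal ?G) (n * k + 1)"
  define m where "m = (\<Sum>i \<in> {1..n}. Poly_Mapping.single i (2 * k))"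
  have lookup_m: "Poly_Mapping.lookup m i = (if i \<in> {1..n} then 2 * k else 0)" for i
    by (simp add: m_def lookup_sum lookup_single when_def)
  have "(Poly_Mapping.single m 1 :: 'k mpoly)
      \<in> symbolic_power (mpoly_ring (pverts ?G)) (edge_ideal ?G) (2 * k * (n - (r + 1)))"
  proof (rule monomial_in_symbolic_power[OF pg])
    show "Poly_Mapping.keys m \<subseteq> pverts ?G"
      by (auto simp: V in_keys_iff lookup_m split: if_splits)
    fix F assume F: "F \<subseteq> pverts ?G" "independent (parcs ?G) F"
    have "card F \<le> r + 1" using card_independent_le[OF n] F by (simp add: V)
    moreover have "card ({1..n} - F) = n - card F"
      using F by (simp add: V card_Diff_subset finite_subset)
    ultimately have "n - (r + 1) \<le> card ({1..n} - F)" by simp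
    moreover have "sum (Poly_Mapping.lookup m) (pverts ?G - F) = 2 * k * card ({1..n} - F)"
      by (simp add: V lookup_m)
    ultimately show "2 * k * (n - (r + 1)) \<le> sum (Poly_Mapping.lookup m) (pverts ?G - F)" by simp
  qed
  then have "(Poly_Mapping.single m 1 :: 'k mpoly) \<in> edge_monomial_ideal ?G (n * k + 1)"
    using sub edge_ideal_power_eq[OF pg, of "n * k + 1", where 'k = 'k] by (auto simp: V)
  then have "edge_multiple (parcs ?G) (n * k + 1) m" by (simp add: mem_edge_monomial_ideal)
  then have "2 * (n * k + 1) \<le> sum (Poly_Mapping.lookup m) {1..n}"
    using pair_graph_parcs(4)[OF pg] by (intro edge_multiple_size) (auto simp: V)
  also have "\<dots> = 2 * (n * k)" by (simp add: lookup_m)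
  finally show False by simp
qed

theorem theorem5p8:
  fixes n r :: nat
  assumes "int r \<le> int n div 2 - 1"
  shows "resurgence (mpoly_ring {1..n}) (edge_ideal (G_graph n r) :: 'k::field mpoly set)
           = ereal (2 * (real n - (real r + 1)) / real n)"
proof (rule antisym)
  let ?R = "mpoly_ring {1..n} :: 'k mpoly ring"
  let ?I = "edge_ideal (G_graph n r) :: 'k mpoly set"
  have n: "2 * r + 2 \<le> n" using assms by linarith
  define c where "c = n - (r + 1)"
  have c: "real n - (real r + 1) = real c" using n by (simp add: c_def of_nat_diff)
  show "resurgence ?R ?I \<le> ereal (2 * (real n - (real r + 1)) / real n)"
    unfolding resurgence_def
  proof (rule Sup_least)
    fix x
    assume "x \<in> {ereal (real s / real t) |s t. 1 \<le> s \<and> 1 \<le> t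
      \<and> \<not> symbolic_power ?R ?I s \<subseteq> ideal_power ?R ?I t}"
    then obtain s t where x: "x = ereal (real s / real t)" and st: "1 \<le> s" "1 \<le> t"
      "\<not> symbolic_power ?R ?I s \<subseteq> ideal_power ?R ?I t" by blast
    from st(3) have "n * s \<le> 2 * c * t"
      using symbolic_power_subset_power[OF n, of t s, where 'k = 'k] unfolding c_def by linarith
    then have "real n * real s \<le> 2 * real c * real t"
      by (metis of_nat_mult of_nat_numeral of_nat_le_iff)
    then show "x \<le> ereal (2 * (real n - (real r + 1)) / real n)"
      using st(2) n unfolding c x by (simp add: field_simps)
  qed
  \<comment> \<open>\<open>Suc k\<close> in place of \<open>k\<close> keeps the symbolic exponent
    positive.\<close>
  define a where "a k = real (2 * Suc k * c) / real (n * Suc k + 1)" for k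
  have a_le: "ereal (a k) \<le> resurgence ?R ?I" for k
    unfolding resurgence_def
  proof (rule Sup_upper)
    have "\<not> symbolic_power ?R ?I (2 * Suc k * c) \<subseteq> ideal_power ?R ?I (n * Suc k + 1)"
      unfolding c_def by (rule symbolic_power_not_subset_power[OF n])
    moreover have "1 \<le> 2 * Suc k * c" using n by (simp add: c_def)
    moreover have "1 \<le> n * Suc k + 1" by simp
    ultimately show "ereal (a k) \<in> {ereal (real s / real t) |s t. 1 \<le> s \<and> 1 \<le> t
        \<and> \<not> symbolic_power ?R ?I s \<subseteq> ideal_power ?R ?I t}"
      unfolding a_def by blast
  qed
  \<comment> \<open>Numerator and denominator of \<open>a k\<close> are divided by
    \<open>Suc k\<close>, which isolates the vanishing term.\<close>
  have "(\<lambda>k. 2 * real c / (real n + inverse (real (Suc k)))) \<longlonglongrightarrow> 2 * real c / (real n + 0)"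
    using n by (intro tendsto_intros LIMSEQ_inverse_real_of_nat) auto
  moreover have "a = (\<lambda>k. 2 * real c / (real n + inverse (real (Suc k))))"
    unfolding a_def by (rule ext) (simp add: field_simps)
  ultimately have "a \<longlonglongrightarrow> 2 * (real n - (real r + 1)) / real n" by (simp add: c)
  then have "(\<lambda>k. ereal (a k)) \<longlonglongrightarrow> ereal (2 * (real n - (real r + 1)) / real n)" by simp
  then show "ereal (2 * (real n - (real r + 1)) / real n) \<le> resurgence ?R ?I"
    by (rule LIMSEQ_le_const2) (use a_le in blast)
qed

end
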